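(* Assume $X\subseteq\mathbb{R}^n$ and $\Theta\subseteq\mathbb{R}^d$ are convex and compact, and: (i) $h(x;\theta)=A(\theta)x+b(\theta)$ with $A(\theta)\in\mathbb{R}^{m\times n}$, $b(\theta)\in\mathbb{R}^m$, and there are constants $L_A,L_b$ with $\|A(\theta)-A(\theta^* )\|\le L_A\|\theta-\theta^*\|$ and $\|b(\theta)-b(\theta^* )\|\le L_b\|\theta-\theta^*\|$ for all $\theta\in\Theta$; (ii) $f(\cdot;\theta)$ is convex on $X$ for all $\theta\in\Theta$, and $|f(x;\theta)-f(x;\theta^* )|\le L_{f,\theta}\|\theta-\theta^*\|$ for all $\theta\in\Theta$, $x\in X$; (iii) there is a continuous function $\kappa:\mathcal{K}^*\to\mathbb{R}$ with positive values such that $X^*(\lambda;\theta)\subseteq X^*(\lambda;\theta^* )+\kappa(\lambda)\|\theta-\theta^*\|\,\mathcal{B}(\mathbf{0},1)$ for all $\lambda\in\mathcal{K}^*$, $\theta\in\Theta$. Let $\{\theta_k\}_{k\ge 0}\subseteq\Theta$ satisfy $\|\theta_k-\theta^*\|\le\tau^k\|\theta_0-\theta^*\|$ for all $k\ge0$, where $\tau\in(0,1)$. Let $c,\alpha_0,\rho_0>0$ and $\beta>1$ be such that $\delta\triangleq\beta\tau<1$, and let $\{x_k,\lambda_k\}$ be generated by IPALM with $$\alpha_k=\alpha_0(k+1)^{-2(1+c)}\beta^{-k},\qquad\rho_k=\rho_0\beta^k,\qquad k\ge0.$$ Let $\bar\lambda_k=\frac1k\sum_{i=1}^k\lambda_i$.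 Then $\lambda^*\triangleq\lim_{k\to\infty}\bar\lambda_k$ exists; moreover $\lambda^*\in\operatorname{argmax}_\lambda g_0(\lambda;\theta^* )$, and for all $k\ge0$ $$|f(x_{k+1};\theta^* )-f^*|\le\frac{B_k}{\beta^k},\qquad d_{-\mathcal{K}}\big(h(x_{k+1};\theta^* )\big)\le\frac1{\beta^k}\Big(\frac{2C'_\lambda}{\rho_0}+L_{h,\theta}\|\theta_0-\theta^*\|\delta^k\Big),$$ where $$C'_\lambda\triangleq\sum_{i=0}^\infty\sqrt{2\alpha_i\rho_i}+\frac{\rho_0\,\kappa_d(\lambda^* )\|\theta_0-\theta^*\|}{1-\beta\tau}+\|\lambda_0-\lambda^*\|,$$ $$B_k\triangleq\frac{\alpha_0}{(k+1)^{2(1+c)}}+\frac1{\rho_0}\big(2C'_\lambda+\|\lambda^*\|\big)^2+\rho_0\Big(L_{h,\theta}\|\theta_0-\theta^*\|\delta^k+\frac{L_{f,\theta}}{\rho_0L_{h,\theta}}\Big)^2.$$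
   Context: $\|\cdot\|$ is the Euclidean norm (spectral norm for matrices), $\mathcal{B}(\mathbf{0},1)$ the closed unit ball. $\mathcal{K}\subseteq\mathbb{R}^m$ is a closed convex cone, $\mathcal{K}^*$ its dual cone; for a closed convex set $C$, $\Pi_C$ is the Euclidean projection and $d_C(y)=\min_{s\in C}\|y-s\|$. $f:\mathbb{R}^n\times\Theta\to\mathbb{R}\cup\{+\infty\}$, $h:\mathbb{R}^n\times\Theta\to\mathbb{R}^m$; $\mathcal{C}(\theta):\ \min_x\{f(x;\theta):-h(x;\theta)\in\mathcal{K},\ x\in X\}$. $\theta^*\in\Theta$ is a fixed parameter (the unique minimizer over $\Theta$ of a learning objective). Standing assumption: $\mathcal{C}(\theta^* )$ has finite optimal value $f^*$ (attained on its solution set), its Lagrangian dual has a solution, and there is no duality gap. Lagrangian: $\mathcal{L}_0(x,\lambda;\theta)=f(x;\theta)+\lambda^\top h(x;\theta)$ if $\lambda\in\mathcal{K}^*$, and $-\infty$ otherwise. For $\rho>0$: $\mathcal{L}_\rho(x,\lambda;\theta)=f(x;\theta)+\frac{\rho}{2}d^2_{-\mathcal{K}}\big(h(x;\theta)+\frac{\lambda}{\rho}\big)-\frac{\|\lambda\|^2}{2\rho}$. For $\rho\ge 0$: $g_\rho(\lambda;\theta)=\inf_{x\in X}\mathcal{L}_\rho(x,\lambda;\theta)$. For $\rho>0$, $\nabla_\lambda\mathcal{L}_\rho(x,\lambda;\theta)=\Pi_{\mathcal{K}^*}\big(\frac{\lambda}{\rho}+h(x;\theta)\big)-\frac{\lambda}{\rho}$.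 $X^*(\lambda;\theta)=\operatorname{argmin}_{x\in X}\mathcal{L}_0(x,\lambda;\theta)$. Constants: $D_x=\max_{x\in X}\|x\|$, $L_{h,\theta}=L_AD_x+L_b$, $L_{h,x}=\max_{\theta\in\Theta}\|A(\theta)\|$ ($\|A(\cdot)\|$ is taken to be continuous on $\Theta$), $\kappa_d(\lambda)=L_{h,\theta}+\kappa(\lambda)L_{h,x}$. IPALM (inexact parametric augmented Lagrangian method): given $\lambda_0\in\mathcal{K}^*$, $x_0\in X$, penalties $\{\rho_k\}\subset(0,\infty)$, tolerances $\{\alpha_k\}$, and $\{\theta_k\}$, for each $k\ge0$: (1) choose any $x_{k+1}\in X$ with $\mathcal{L}_{\rho_k}(x_{k+1},\lambda_k;\theta_k)\le g_{\rho_k}(\lambda_k;\theta_k)+\alpha_k$; (2) set $\lambda_{k+1}=\lambda_k+\rho_k\nabla_\lambda\mathcal{L}_{\rho_k}(x_{k+1},\lambda_k;\theta_k)$, i.e. $\lambda_{k+1}=\Pi_{\mathcal{K}^*}(\lambda_k+\rho_kh(x_{k+1};\theta_k))$.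
   Formalization: It is additionally assumed that X*(λ;θ) is nonempty for all λ in K* and θ in Θ (automatic for lower semicontinuous f; the claim can fail otherwise), and the bound on |f(x_{k+1};θ* )−f*| is stated only when L_{h,θ} ≠ 0, since B_k divides by it. *)

theory Defs
  imports "HOL-Analysis.Analysis"
begin

definition dual_cone :: "'a::real_inner set \<Rightarrow> 'a set" where
  "dual_cone K = {y. \<forall>z\<in>K. 0 \<le> y \<bullet> z}"

(* Library convex_on is for real-valued functions only.  This version is applied only to
   functions that avoid -\<infinity>, so the right-hand side never adds infinities of opposite
   sign; at t = 0 and t = 1 the ereal convention 0 * \<infinity> = 0 makes it trivial. *)
definition ereal_convex_on :: "'a::real_vector set \<Rightarrow> ('a \<Rightarrow> ereal) \<Rightarrow> bool" where
  "ereal_convex_on S F \<longleftrightarrow> convex S \<and>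
     (\<forall>x\<in>S. \<forall>y\<in>S. \<forall>t\<in>{0..1::real}.
        F ((1 - t) *\<^sub>R x + t *\<^sub>R y) \<le> ereal (1 - t) * F x + ereal t * F y)"

(* In what follows f x \<theta> is the objective, h x \<theta> the constraint map and -h x \<theta> \<in> K the
   constraint; lam is the multiplier. *)

definition feasible ::
  "'x set \<Rightarrow> 'y::real_inner set \<Rightarrow> ('x \<Rightarrow> 'p \<Rightarrow> 'y) \<Rightarrow> 'p \<Rightarrow> 'x set" where
  "feasible X K h \<theta> = {x \<in> X. - h x \<theta> \<in> K}"

definition opt_value ::
  "'x set \<Rightarrow> 'y::real_inner set \<Rightarrow> ('x \<Rightarrow> 'p \<Rightarrow> ereal) \<Rightarrow> ('x \<Rightarrow> 'p \<Rightarrow> 'y) \<Rightarrow> 'p \<Rightarrow> ereal" where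
  "opt_value X K f h \<theta> = (INF x\<in>feasible X K h \<theta>. f x \<theta>)"

(* The ordinary Lagrangian for \<rho> = 0, the augmented one for \<rho> > 0 (never used for \<rho> < 0). *)
definition lagrangian ::
  "'y::real_inner set \<Rightarrow> ('x \<Rightarrow> 'p \<Rightarrow> ereal) \<Rightarrow> ('x \<Rightarrow> 'p \<Rightarrow> 'y) \<Rightarrow>
   real \<Rightarrow> 'x \<Rightarrow> 'y \<Rightarrow> 'p \<Rightarrow> ereal" where
  "lagrangian K f h \<rho> x lam \<theta> =
     (if \<rho> = 0 then
        (if lam \<in> dual_cone K then f x \<theta> + ereal (lam \<bullet> h x \<theta>) else -\<infinity>)
      else
        f x \<theta> + ereal (\<rho> / 2 * (infdist (h x \<theta> + (1 / \<rho>) *\<^sub>R lam) (uminus ` K))\<^sup>2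
                        - (norm lam)\<^sup>2 / (2 * \<rho>)))"

definition dual_fun ::
  "'x set \<Rightarrow> 'y::real_inner set \<Rightarrow> ('x \<Rightarrow> 'p \<Rightarrow> ereal) \<Rightarrow> ('x \<Rightarrow> 'p \<Rightarrow> 'y) \<Rightarrow>
   real \<Rightarrow> 'y \<Rightarrow> 'p \<Rightarrow> ereal" where
  "dual_fun X K f h \<rho> lam \<theta> = (INF x\<in>X. lagrangian K f h \<rho> x lam \<theta>)"

definition lagr_argmin ::
  "'x set \<Rightarrow> 'y::real_inner set \<Rightarrow> ('x \<Rightarrow> 'p \<Rightarrow> ereal) \<Rightarrow> ('x \<Rightarrow> 'p \<Rightarrow> 'y) \<Rightarrow>
   'y \<Rightarrow> 'p \<Rightarrow> 'x set" where
  "lagr_argmin X K f h lam \<theta> =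
     {x. is_arg_min (\<lambda>x. lagrangian K f h 0 x lam \<theta>) (\<lambda>x. x \<in> X) x}"

(* Closed form of the gradient in lam of the augmented Lagrangian, for \<rho> > 0; it does not
   involve f. *)
definition lagr_grad ::
  "'y::{real_inner,heine_borel} set \<Rightarrow> ('x \<Rightarrow> 'p \<Rightarrow> 'y) \<Rightarrow> real \<Rightarrow> 'x \<Rightarrow> 'y \<Rightarrow> 'p \<Rightarrow> 'y" where
  "lagr_grad K h \<rho> x lam \<theta> =
     closest_point (dual_cone K) ((1 / \<rho>) *\<^sub>R lam + h x \<theta>) - (1 / \<rho>) *\<^sub>R lam"

(* x and lam are sequences that the inexact parametric augmented Lagrangian method may
   generate from penalties \<rho>, tolerances \<alpha> and parameters \<theta>; x (Suc k) is any
   \<alpha> k-minimizer, so the pair is not determined by the data. *)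
definition ipalm ::
  "'x set \<Rightarrow> 'y::{real_inner,heine_borel} set \<Rightarrow> ('x \<Rightarrow> 'p \<Rightarrow> ereal) \<Rightarrow> ('x \<Rightarrow> 'p \<Rightarrow> 'y) \<Rightarrow>
   (nat \<Rightarrow> real) \<Rightarrow> (nat \<Rightarrow> real) \<Rightarrow> (nat \<Rightarrow> 'p) \<Rightarrow> (nat \<Rightarrow> 'x) \<Rightarrow> (nat \<Rightarrow> 'y) \<Rightarrow> bool" where
  "ipalm X K f h \<rho> \<alpha> \<theta> x lam \<longleftrightarrow>
     lam 0 \<in> dual_cone K \<and> x 0 \<in> X \<and>
     (\<forall>k. x (Suc k) \<in> X \<and>
          lagrangian K f h (\<rho> k) (x (Suc k)) (lam k) (\<theta> k)
            \<le> dual_fun X K f h (\<rho> k) (lam k) (\<theta> k) + ereal (\<alpha> k) \<and>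
          lam (Suc k) = lam k + \<rho> k *\<^sub>R lagr_grad K h (\<rho> k) (x (Suc k)) (lam k) (\<theta> k))"

end

theory Submission
  imports Defs
begin

text \<open>
  Each iteration of the augmented Lagrangian method is an inexact proximal step on the dual function of
  the current parameter \<open>\<theta> k\<close>. By \<open>aug_penalty_eq\<close> and \<open>aug_penalty_ge\<close> the penalty is a maximum of
  \<open>p \<bullet> h - \<parallel>p - \<lambda>\<parallel>\<^sup>2 / (2 \<rho>)\<close> over the dual cone, and a minimax argument (\<open>proximal_multiplier\<close>)
  turns the minimization in \<open>x\<close> into the maximization of the dual function minus
  \<open>\<parallel>p - \<lambda>\<parallel>\<^sup>2 / (2 \<rho>)\<close>. Minimizing up to \<open>\<alpha> k\<close> puts the new multiplier within
  \<open>sqrt (2 * \<alpha> k * \<rho> k)\<close> of the exact proximal point.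

  An exact proximal step with the true parameter would not increase the distance to any dual solution
  \<open>\<mu>\<close>. With \<open>\<theta> k\<close> it does so by at most \<open>\<rho> k * \<kappa>\<^sub>d \<mu> * \<parallel>\<theta> k - \<theta>s\<parallel>\<close>, by
  \<open>proximal_step_to_dual_solution\<close>. This is the delicate point, since the stability assumption bounds
  the minimizers at \<open>\<theta> k\<close> by those at \<open>\<theta>s\<close> and not conversely. Both error terms are summable, the
  second because \<open>\<beta> * \<tau> < 1\<close>. Hence the distances to dual solutions are quasi-Fejer
  and bounded by the constant \<open>C' \<mu>\<close>. As the penalties tend to infinity, cluster points of the multipliers
  are dual solutions, so the multipliers themselves converge (\<open>lam_converges\<close>), and with them their
  averages, to a dual solution \<open>ls\<close> with \<open>\<parallel>lam k - ls\<parallel> \<le> C' ls\<close> for all \<open>k\<close>.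

  The rates follow. The constraint violation at step \<open>k\<close> is at most the length of the multiplier
  step divided by \<open>\<rho> k\<close>, plus the parameter error (\<open>infeasibility_bound\<close>). The objective is bounded from
  above by comparison with an optimal point in the augmented Lagrangian, and from below by the saddle-point
  inequality and the constraint violation (\<open>objective_bound\<close>).
\<close>

section \<open>Dual cones and the augmented Lagrangian penalty\<close>

lemma convex_dual_cone: "convex (dual_cone K)"
  unfolding dual_cone_def convex_def by (auto simp: inner_add_left)

lemma closed_dual_cone: "closed (dual_cone K)"
proof -
  have "dual_cone K = (\<Inter>z\<in>K. {y. 0 \<le> y \<bullet> z})"
    by (auto simp: dual_cone_def)
  then show ?thesis
    by (auto intro!: closed_INT closed_Collect_le continuous_intros)
qed

lemma zero_in_dual_cone: "0 \<in> dual_cone K"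
  by (simp add: dual_cone_def)

lemma scaleR_in_dual_cone: "0 \<le> c \<Longrightarrow> y \<in> dual_cone K \<Longrightarrow> c *\<^sub>R y \<in> dual_cone K"
  by (simp add: dual_cone_def)

text \<open>
  The bipolar theorem, in the form that projection residuals need: a point of the polar of the
  dual cone that lay outside \<open>- K\<close> could be separated from it, and the normal of the separating
  hyperplane would be an element of the dual cone contradicting polarity.
\<close>
lemma polar_of_dual_cone:
  fixes K :: "'y::euclidean_space set"
  assumes K: "closed K" "convex_cone K" and r: "\<And>z. z \<in> dual_cone K \<Longrightarrow> r \<bullet> z \<le> 0"
  shows "- r \<in> K"
proof (rule ccontr)
  assume "- r \<notin> K"
  then obtain a \<beta> where a: "a \<bullet> (- r) < \<beta>" "\<And>z. z \<in> K \<Longrightarrow> \<beta> < a \<bullet> z"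
    using separating_hyperplane_closed_point[of K "- r"] K by (auto simp: convex_cone_def)
  have \<beta>0: "\<beta> < 0"
    using a(2)[OF convex_cone_contains_0[OF K(2)]] by simp
  have "a \<in> dual_cone K"
    unfolding dual_cone_def
  proof clarify
    fix z assume z: "z \<in> K"
    show "0 \<le> a \<bullet> z"
    proof (rule ccontr)
      assume neg: "\<not> 0 \<le> a \<bullet> z"
      have "(\<beta> / (a \<bullet> z)) *\<^sub>R z \<in> K"
        using K(2) z neg \<beta>0 by (intro convex_cone_scaleR) (auto intro: divide_nonpos_neg)
      from a(2)[OF this] neg show False by simp
    qed
  qed
  with r[of a] a(1) \<beta>0 show False by (simp add: inner_commute)
qed

text \<open>
  Moreau's decomposition of \<open>w\<close> into its projection on the dual cone and an orthogonal remainder in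
  \<open>- K\<close>. Orthogonality comes from testing the projection inequality at \<open>0\<close> and at \<open>2 c\<close>.
\<close>
lemma moreau_decomposition:
  fixes K :: "'y::euclidean_space set" and w :: 'y
  assumes K: "closed K" "convex_cone K"
  defines "c \<equiv> closest_point (dual_cone K) w"
  shows "c \<in> dual_cone K" "z \<in> dual_cone K \<Longrightarrow> z \<bullet> (w - c) \<le> 0" "c \<bullet> (w - c) = 0"
    "w - c \<in> uminus ` K"
proof -
  let ?D = "dual_cone K"
  show cD: "c \<in> ?D"
    unfolding c_def using closed_dual_cone zero_in_dual_cone by (intro closest_point_in_set) auto
  have proj: "(w - c) \<bullet> (z - c) \<le> 0" if "z \<in> ?D" for z
    unfolding c_def by (intro closest_point_dot convex_dual_cone closed_dual_cone that)
  have "2 *\<^sub>R c \<in> ?D" using cD by (intro scaleR_in_dual_cone) auto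
  from proj[OF this] proj[OF zero_in_dual_cone] show orth: "c \<bullet> (w - c) = 0"
    by (simp add: scaleR_2 inner_commute)
  show *: "z \<bullet> (w - c) \<le> 0" if "z \<in> ?D" for z
    using proj[OF that] orth by (simp add: inner_diff inner_commute)
  have "- (w - c) \<in> K"
    using * by (intro polar_of_dual_cone[OF K]) (simp add: inner_commute)
  then show "w - c \<in> uminus ` K" by (metis imageI minus_minus)
qed

lemma infdist_neg_cone:
  fixes K :: "'y::euclidean_space set"
  assumes K: "closed K" "convex_cone K"
  shows "infdist w (uminus ` K) = norm (closest_point (dual_cone K) w)"
proof -
  define c where "c = closest_point (dual_cone K) w"
  note m = moreau_decomposition[OF K, where w = w, folded c_def]
  have "norm c \<le> dist w s" if "s \<in> uminus ` K" for s
  proof -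
    have "c \<bullet> s \<le> 0" using m(1) that by (auto simp: dual_cone_def)
    then have "norm c * norm c \<le> c \<bullet> (w - s)"
      using m(3) by (simp add: inner_diff dot_square_norm power2_eq_square)
    also have "\<dots> \<le> norm c * norm (w - s)" by (rule norm_cauchy_schwarz)
    finally show ?thesis
      by (cases "c = 0") (auto simp: dist_norm)
  qed
  then have "norm c \<le> infdist w (uminus ` K)"
    using K(2) by (subst infdist_notempty) (auto intro!: cINF_greatest simp: convex_cone_def)
  moreover have "infdist w (uminus ` K) \<le> norm c"
    using infdist_le[OF m(4), of w] by (simp add: dist_norm)
  ultimately show ?thesis by (simp add: c_def)
qed

text \<open>
  The part of the augmented Lagrangian that is added to the objective, as a function of the
  multiplier \<open>l\<close> and of the constraint value \<open>y\<close>.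
\<close>
definition aug_penalty :: "'y::real_inner set \<Rightarrow> real \<Rightarrow> 'y \<Rightarrow> 'y \<Rightarrow> real" where
  "aug_penalty K \<rho> l y =
     \<rho> / 2 * (infdist (y + (1 / \<rho>) *\<^sub>R l) (uminus ` K))\<^sup>2 - (norm l)\<^sup>2 / (2 * \<rho>)"

text \<open>
  Since the dual cone is invariant under scaling, this is the projection of \<open>l + \<rho> y\<close>; projecting
  \<open>y + l / \<rho>\<close> first keeps the point visible whose distance to \<open>- K\<close> the penalty measures.
\<close>
definition mult_update ::
    "'y::{real_inner,heine_borel} set \<Rightarrow> real \<Rightarrow> 'y \<Rightarrow> 'y \<Rightarrow> 'y" where
  "mult_update K \<rho> l y = \<rho> *\<^sub>R closest_point (dual_cone K) (y + (1 / \<rho>) *\<^sub>R l)"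

context
  fixes K :: "'y::euclidean_space set" and \<rho> :: real and l :: 'y
  assumes K: "closed K" "convex_cone K" and \<rho>: "0 < \<rho>"
begin

lemma mult_update_in_dual_cone: "mult_update K \<rho> l y \<in> dual_cone K"
  unfolding mult_update_def
  using \<rho> moreau_decomposition(1)[OF K] by (intro scaleR_in_dual_cone) auto

lemma norm_mult_update:
  "norm (mult_update K \<rho> l y) = \<rho> * infdist (y + (1 / \<rho>) *\<^sub>R l) (uminus ` K)"
  using \<rho> by (simp add: mult_update_def infdist_neg_cone[OF K])

text \<open>
  A step that moves the multiplier little certifies near-feasibility: the Moreau remainder of
  \<open>y + l / \<rho>\<close> lies in \<open>- K\<close> and differs from \<open>y\<close> by the step divided by \<open>\<rho>\<close>.
\<close>
lemma mult_update_residual: "infdist y (uminus ` K) \<le> norm (mult_update K \<rho> l y - l) / \<rho>"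
proof -
  define w where "w = y + (1 / \<rho>) *\<^sub>R l"
  define c where "c = closest_point (dual_cone K) w"
  have "infdist y (uminus ` K) \<le> dist y (w - c)"
    using moreau_decomposition(4)[OF K, of w] unfolding c_def by (rule infdist_le)
  also have "y - (w - c) = (1 / \<rho>) *\<^sub>R (mult_update K \<rho> l y - l)"
    using \<rho> by (simp add: mult_update_def w_def c_def algebra_simps)
  then have "dist y (w - c) = norm (mult_update K \<rho> l y - l) / \<rho>"
    using \<rho> by (simp add: dist_norm)
  finally show ?thesis .
qed

text \<open>
  This lemma and the next say that the penalty is the maximum over \<open>p\<close> in the dual cone of
  \<open>p \<bullet> y - \<parallel>p - l\<parallel>\<^sup>2 / (2 \<rho>)\<close>, attained at the updated multiplier; the extra square in the next
  one is the strong concavity of this quadratic around its maximizer.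
\<close>
lemma aug_penalty_eq:
  "aug_penalty K \<rho> l y =
     mult_update K \<rho> l y \<bullet> y - (norm (mult_update K \<rho> l y - l))\<^sup>2 / (2 * \<rho>)"
proof -
  define w where "w = y + (1 / \<rho>) *\<^sub>R l"
  define c where "c = closest_point (dual_cone K) w"
  have "c \<bullet> (w - c) = 0" unfolding c_def by (rule moreau_decomposition(3)[OF K])
  then have cy: "c \<bullet> y = c \<bullet> c - (c \<bullet> l) / \<rho>"
    by (simp add: w_def inner_diff inner_add)
  have "aug_penalty K \<rho> l y = \<rho> / 2 * (c \<bullet> c) - (l \<bullet> l) / (2 * \<rho>)"
    by (simp add: aug_penalty_def infdist_neg_cone[OF K] power2_norm_eq_inner c_def w_def)
  moreover have "mult_update K \<rho> l y = \<rho> *\<^sub>R c" by (simp add: mult_update_def c_def w_def)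
  moreover have "(norm (\<rho> *\<^sub>R c - l))\<^sup>2 / (2 * \<rho>)
      = \<rho> / 2 * (c \<bullet> c) - c \<bullet> l + (l \<bullet> l) / (2 * \<rho>)"
    using \<rho> by (simp add: power2_norm_eq_inner inner_diff inner_commute field_simps)
  moreover have "\<rho> * (c \<bullet> y) = \<rho> * (c \<bullet> c) - c \<bullet> l"
    using \<rho> by (simp add: cy field_simps)
  ultimately show ?thesis by simp
qed

lemma aug_penalty_ge:
  assumes "p \<in> dual_cone K"
  shows "p \<bullet> y - (norm (p - l))\<^sup>2 / (2 * \<rho>) + (norm (p - mult_update K \<rho> l y))\<^sup>2 / (2 * \<rho>)
           \<le> aug_penalty K \<rho> l y"
proof -
  define w where "w = y + (1 / \<rho>) *\<^sub>R l"
  define c where "c = closest_point (dual_cone K) w"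
  have "p \<bullet> (w - c) \<le> 0" unfolding c_def by (rule moreau_decomposition(2)[OF K assms])
  then have py: "p \<bullet> y \<le> p \<bullet> c - (p \<bullet> l) / \<rho>"
    by (simp add: w_def inner_diff inner_add)
  have "aug_penalty K \<rho> l y = \<rho> / 2 * (c \<bullet> c) - (l \<bullet> l) / (2 * \<rho>)"
    by (simp add: aug_penalty_def infdist_neg_cone[OF K] power2_norm_eq_inner c_def w_def)
  moreover have "mult_update K \<rho> l y = \<rho> *\<^sub>R c" by (simp add: mult_update_def c_def w_def)
  moreover have "(norm (p - l))\<^sup>2 / (2 * \<rho>)
      = (p \<bullet> p) / (2 * \<rho>) - (p \<bullet> l) / \<rho> + (l \<bullet> l) / (2 * \<rho>)"
    using \<rho> by (simp add: power2_norm_eq_inner inner_diff inner_commute field_simps)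
  moreover have "(norm (p - \<rho> *\<^sub>R c))\<^sup>2 / (2 * \<rho>)
      = (p \<bullet> p) / (2 * \<rho>) - p \<bullet> c + \<rho> / 2 * (c \<bullet> c)"
    using \<rho> by (simp add: power2_norm_eq_inner inner_diff inner_commute field_simps)
  ultimately show ?thesis using py by simp
qed

text \<open>
  As a maximum of \<open>1 / \<rho>\<close>-strongly concave functions of the multiplier, the penalty is smooth in
  the constraint value, with gradient the updated multiplier.
\<close>
lemma aug_penalty_smooth:
  "aug_penalty K \<rho> l z
     \<le> aug_penalty K \<rho> l y + mult_update K \<rho> l y \<bullet> (z - y) + \<rho> / 2 * (norm (z - y))\<^sup>2"
proof -
  define P Q where "P = mult_update K \<rho> l y" and "Q = mult_update K \<rho> l z"
  have "Q \<bullet> y - (norm (Q - l))\<^sup>2 / (2 * \<rho>) + (norm (Q - P))\<^sup>2 / (2 * \<rho>) \<le> aug_penalty K \<rho> l y"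
    unfolding P_def using mult_update_in_dual_cone by (intro aug_penalty_ge) (simp add: Q_def)
  moreover have "aug_penalty K \<rho> l z = Q \<bullet> z - (norm (Q - l))\<^sup>2 / (2 * \<rho>)"
    by (simp add: Q_def aug_penalty_eq)
  moreover have "(Q - P) \<bullet> (z - y) \<le> (norm (Q - P))\<^sup>2 / (2 * \<rho>) + \<rho> / 2 * (norm (z - y))\<^sup>2"
  proof -
    have "0 \<le> (norm ((Q - P) - \<rho> *\<^sub>R (z - y)))\<^sup>2 / (2 * \<rho>)" using \<rho> by simp
    also have "\<dots> = (norm (Q - P))\<^sup>2 / (2 * \<rho>) + \<rho> / 2 * (norm (z - y))\<^sup>2 - (Q - P) \<bullet> (z - y)"
      using \<rho> unfolding power2_norm_eq_inner inner_diff_left[of "Q - P"] inner_diff_right[of _ "Q - P"]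
      by (simp add: inner_commute[of "z - y" "Q - P"] diff_divide_distrib add_divide_distrib)
    finally show ?thesis by simp
  qed
  ultimately show ?thesis
    by (simp add: P_def inner_diff)
qed

end

section \<open>Averages and quasi-Fejer sequences\<close>

lemma cesaro_mean:
  fixes u :: "nat \<Rightarrow> 'a::real_normed_vector"
  assumes "u \<longlonglongrightarrow> l"
  shows "(\<lambda>k. (1 / real k) *\<^sub>R (\<Sum>i=1..k. u i)) \<longlonglongrightarrow> l"
proof (rule LIMSEQ_I)
  fix \<epsilon> :: real assume \<epsilon>: "0 < \<epsilon>"
  obtain N where N: "\<And>i. i \<ge> N \<Longrightarrow> norm (u i - l) < \<epsilon> / 2"
    using LIMSEQ_D[OF assms, of "\<epsilon> / 2"] \<epsilon> by auto
  define S where "S = (\<Sum>i=1..N. norm (u i - l))"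
  have "(\<lambda>k. S / real k) \<longlonglongrightarrow> 0" by (rule lim_const_over_n)
  from order_tendstoD(2)[OF this, of "\<epsilon> / 2"] \<epsilon>
  obtain M where M: "\<And>k. k \<ge> M \<Longrightarrow> S / real k < \<epsilon> / 2"
    by (auto simp: eventually_sequentially)
  \<comment> \<open>The first \<open>N\<close> terms contribute at most \<open>S / k\<close>, all later ones at most \<open>\<epsilon> / 2\<close> on average.\<close>
  have "norm ((1 / real k) *\<^sub>R (\<Sum>i=1..k. u i) - l) < \<epsilon>" if k: "k \<ge> max (max M N) 1" for k
  proof -
    have "(\<Sum>i=1..k. u i) - real k *\<^sub>R l = (\<Sum>i=1..k. u i - l)"
      by (simp add: sum_subtractf scaleR_left.sum[symmetric] sum_constant_scaleR)
    moreover have "(1 / real k) *\<^sub>R (\<Sum>i=1..k. u i) - l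
        = (1 / real k) *\<^sub>R ((\<Sum>i=1..k. u i) - real k *\<^sub>R l)"
      using k by (simp add: scaleR_diff_right)
    ultimately have "norm ((1 / real k) *\<^sub>R (\<Sum>i=1..k. u i) - l)
        = norm ((1 / real k) *\<^sub>R (\<Sum>i=1..k. u i - l))" by simp
    also have "\<dots> \<le> (\<Sum>i=1..k. norm (u i - l)) / real k"
      using norm_sum[of "\<lambda>i. u i - l" "{1..k}"] k by (simp add: divide_right_mono)
    also have "\<dots> \<le> S / real k + \<epsilon> / 2"
    proof -
      have "(\<Sum>i=1..k. norm (u i - l)) = S + (\<Sum>i=N+1..k. norm (u i - l))"
        unfolding S_def using k sum.ub_add_nat[of 1 N "\<lambda>i. norm (u i - l)" "k - N"] by simp
      moreover have "(\<Sum>i=N+1..k. norm (u i - l)) \<le> (\<Sum>i=N+1..k. \<epsilon> / 2)"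
        using N by (intro sum_mono) (auto intro: less_imp_le)
      moreover have "(\<Sum>i=N+1..k. \<epsilon> / 2) \<le> real k * (\<epsilon> / 2)"
        using \<epsilon> by (simp add: mult_right_mono)
      ultimately show ?thesis using k by (simp add: field_simps)
    qed
    also have "\<dots> < \<epsilon>"
      using add_strict_right_mono[OF M[of k], of "\<epsilon> / 2"] k by (simp only: field_sum_of_halves)
    finally show ?thesis .
  qed
  then show "\<exists>no. \<forall>k\<ge>no. norm ((1 / real k) *\<^sub>R (\<Sum>i=1..k. u i) - l) < \<epsilon>" by blast
qed

text \<open>
  Quasi-Fejer sequences: distances that grow by at most a summable amount per step.
\<close>
lemma quasi_fejer_bound:
  fixes a e :: "nat \<Rightarrow> real"
  assumes step: "\<And>k. a (Suc k) \<le> a k + e k" and e: "\<And>k. 0 \<le> e k" "summable e" and "n \<le> k"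
  shows "a k \<le> a n + (\<Sum>i. e (i + n))"
proof -
  have "a (n + j) \<le> a n + (\<Sum>i<j. e (i + n))" for j
  proof (induction j)
    case (Suc j)
    then show ?case using step[of "n + j"] by (simp add: add.commute)
  qed simp
  from this[of "k - n"] have "a k \<le> a n + (\<Sum>i<k - n. e (i + n))"
    using \<open>n \<le> k\<close> by simp
  also have "(\<Sum>i<k - n. e (i + n)) \<le> (\<Sum>i. e (i + n))"
    using e by (intro sum_le_suminf) (simp_all only: summable_iff_shift finite_lessThan)
  finally show ?thesis by simp
qed

lemma quasi_fejer_tendsto_0:
  fixes a e :: "nat \<Rightarrow> real"
  assumes a: "\<And>k. 0 \<le> a k" and step: "\<And>k. a (Suc k) \<le> a k + e k"
    and e: "\<And>k. 0 \<le> e k" "summable e"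
    and sub: "strict_mono r" "(\<lambda>j. a (r j)) \<longlonglongrightarrow> 0"
  shows "a \<longlonglongrightarrow> 0"
proof (rule LIMSEQ_I)
  fix \<epsilon> :: real assume \<epsilon>: "0 < \<epsilon>"
  have "(\<lambda>j. \<Sum>i. e (i + r j)) \<longlonglongrightarrow> 0"
    using LIMSEQ_subseq_LIMSEQ[OF suminf_exist_split2[OF e(2)] sub(1)] by (simp add: o_def)
  from tendsto_add[OF sub(2) this] have "(\<lambda>j. a (r j) + (\<Sum>i. e (i + r j))) \<longlonglongrightarrow> 0" by simp
  from order_tendstoD(2)[OF this \<epsilon>] obtain j where j: "a (r j) + (\<Sum>i. e (i + r j)) < \<epsilon>"
    by (auto simp: eventually_sequentially)
  have "norm (a k - 0) < \<epsilon>" if "r j \<le> k" for k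
    using quasi_fejer_bound[of a e, OF step e that] j a[of k] by simp
  then show "\<exists>no. \<forall>k\<ge>no. norm (a k - 0) < \<epsilon>" by blast
qed

section \<open>Proximal points of the dual function\<close>

text \<open>
  The point \<open>p\<close> maximizes \<open>g q - \<parallel>q - l\<parallel>\<^sup>2 / (2 \<rho>)\<close> over the dual cone, where
  \<open>g q = inf (F + q \<bullet> H)\<close> is the ordinary dual function. The last conclusion is its maximality,
  with the quadratic gain of strong concavity, written without \<open>g\<close>: \<open>\<gamma>\<close> runs through the lower
  bounds of \<open>g q\<close>, and \<open>x\<close> through the points over which the infimum \<open>g p\<close> is taken. The middle
  conclusion is Rockafellar's estimate: minimizing the augmented Lagrangian \<open>G\<close> up to \<open>\<alpha>\<close> gives
  the proximal point up to \<open>sqrt (2 \<rho> \<alpha>)\<close>.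

  Both rest on strong duality: the infimum \<open>v\<close> of \<open>G\<close> is the value of the proximal problem at
  \<open>p\<close>. As \<open>F\<close> is only convex, \<open>G\<close> may have no minimizer. Therefore \<open>p\<close> is obtained as a cluster
  point of the multipliers \<open>p n\<close> that belong to a minimizing sequence \<open>X n\<close>.
\<close>
lemma proximal_multiplier:
  fixes C :: "'x::real_vector set" and F :: "'x \<Rightarrow> real" and H :: "'x \<Rightarrow> 'y::euclidean_space"
    and l :: 'y
  assumes K: "closed K" "convex_cone K" and \<rho>: "0 < \<rho>"
    and F: "convex_on C F" "bdd_below (F ` C)" and "C \<noteq> {}"
    and H: "\<And>x y t. H ((1 - t) *\<^sub>R x + t *\<^sub>R y) = (1 - t) *\<^sub>R H x + t *\<^sub>R H y"
    and bdd: "bounded (H ` C)"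
  defines "G \<equiv> \<lambda>x. F x + aug_penalty K \<rho> l (H x)"
  obtains p where "p \<in> dual_cone K"
    and "\<And>x \<alpha>. x \<in> C \<Longrightarrow> (\<And>z. z \<in> C \<Longrightarrow> G x \<le> G z + \<alpha>) \<Longrightarrow>
           (norm (mult_update K \<rho> l (H x) - p))\<^sup>2 \<le> 2 * \<rho> * \<alpha>"
    and "\<And>q \<gamma> x. q \<in> dual_cone K \<Longrightarrow> (\<And>z. z \<in> C \<Longrightarrow> \<gamma> \<le> F z + q \<bullet> H z) \<Longrightarrow> x \<in> C \<Longrightarrow>
           \<gamma> - (norm (q - l))\<^sup>2 / (2 * \<rho>) + (norm (q - p))\<^sup>2 / (2 * \<rho>)
             \<le> F x + p \<bullet> H x - (norm (p - l))\<^sup>2 / (2 * \<rho>)"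
proof -
  let ?P = "mult_update K \<rho> l"
  obtain M where M: "\<And>x. x \<in> C \<Longrightarrow> norm (H x) \<le> M"
    using bdd by (auto simp: bounded_iff)
  obtain m where m: "\<And>x. x \<in> C \<Longrightarrow> m \<le> F x"
    using F(2) by (auto simp: bdd_below_def)
  note PD = mult_update_in_dual_cone[OF K \<rho>]
  define v where "v = Inf (G ` C)"
  have "m - (norm l)\<^sup>2 / (2 * \<rho>) \<le> G x" if "x \<in> C" for x
  proof -
    have "0 \<le> (norm (0 - ?P (H x)))\<^sup>2 / (2 * \<rho>)" using \<rho> by simp
    then have "- ((norm l)\<^sup>2 / (2 * \<rho>)) \<le> aug_penalty K \<rho> l (H x)"
      using aug_penalty_ge[OF K \<rho> zero_in_dual_cone, of "H x" l]
      by (simp only: inner_zero_left diff_0 norm_minus_cancel)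
    with m[OF that] show ?thesis by (simp add: G_def)
  qed
  then have bddG: "bdd_below (G ` C)" by (auto simp: bdd_below_def)
  have v_le: "v \<le> G x" if "x \<in> C" for x
    unfolding v_def using bddG that by (rule cINF_lower)
  \<comment> \<open>Optimality of \<open>X n\<close> up to the square of \<open>e n\<close> is exploited below along a step of length \<open>e n\<close>:
     dividing by the step leaves an error of order \<open>e n\<close>.\<close>
  define e :: "nat \<Rightarrow> real" where "e = (\<lambda>n. 1 / real (Suc n))"
  have e: "0 < e n" "e n \<le> 1" for n by (auto simp: e_def)
  have e0: "e \<longlonglongrightarrow> 0" unfolding e_def using LIMSEQ_inverse_real_of_nat by (simp add: inverse_eq_divide)
  have "\<exists>x\<in>C. G x < v + (e n)\<^sup>2" for n
    using cInf_lessD[of "G ` C" "v + (e n)\<^sup>2"] \<open>C \<noteq> {}\<close> e(1)[of n] by (auto simp: v_def)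
  then obtain X where X: "\<And>n. X n \<in> C" "\<And>n. G (X n) < v + (e n)\<^sup>2" by metis
  define p where "p = (\<lambda>n. ?P (H (X n)))"
  have pD: "p n \<in> dual_cone K" for n by (simp add: p_def PD)
  \<comment> \<open>First-order optimality of \<open>X n\<close>: moving towards \<open>z\<close>, convexity of \<open>F\<close> and smoothness of the
     penalty show that \<open>X n\<close> nearly minimizes \<open>F + p n \<bullet> H\<close>.\<close>
  have key: "v - e n * (1 + 2 * \<rho> * M\<^sup>2) \<le> F z + p n \<bullet> H z - (norm (p n - l))\<^sup>2 / (2 * \<rho>)"
    if z: "z \<in> C" for n z
  proof -
    define t y where "t = e n" and "y = (1 - t) *\<^sub>R X n + t *\<^sub>R z"
    have t: "0 < t" "t \<le> 1" using e by (auto simp: t_def)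
    have yC: "y \<in> C"
      unfolding y_def using F(1) X(1) z t by (intro convexD_alt) (auto simp: convex_on_def)
    have Fy: "F y \<le> (1 - t) * F (X n) + t * F z"
      unfolding y_def using t by (intro convex_onD[OF F(1)] X z) auto
    have Hy: "H y - H (X n) = t *\<^sub>R (H z - H (X n))"
      unfolding y_def H by (simp add: algebra_simps)
    have "norm (H z - H (X n)) \<le> 2 * M"
      using norm_triangle_ineq4[of "H z" "H (X n)"] M[OF z] M[OF X(1), of n] by simp
    then have dist: "(norm (H z - H (X n)))\<^sup>2 \<le> (2 * M)\<^sup>2"
      by (intro power_mono) auto
    have "G (X n) - t\<^sup>2 \<le> G y" using X(2)[of n] v_le[OF yC] by (simp add: t_def)
    also have "\<dots> \<le> (1 - t) * F (X n) + t * F z + (aug_penalty K \<rho> l (H (X n))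
        + p n \<bullet> (H y - H (X n)) + \<rho> / 2 * (norm (H y - H (X n)))\<^sup>2)"
      unfolding G_def p_def by (intro add_mono Fy aug_penalty_smooth[OF K \<rho>])
    also have "p n \<bullet> (H y - H (X n)) = t * (p n \<bullet> (H z - H (X n)))" by (simp add: Hy)
    also have "\<rho> / 2 * (norm (H y - H (X n)))\<^sup>2 = t\<^sup>2 * (\<rho> / 2 * (norm (H z - H (X n)))\<^sup>2)"
      by (simp add: Hy power_mult_distrib)
    also have "\<dots> \<le> t\<^sup>2 * (2 * \<rho> * M\<^sup>2)"
    proof (intro mult_left_mono)
      show "\<rho> / 2 * (norm (H z - H (X n)))\<^sup>2 \<le> 2 * \<rho> * M\<^sup>2"
        using mult_left_mono[OF dist, of "\<rho> / 2"] \<rho> by (simp add: power_mult_distrib)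
    qed auto
    finally have "t * (F (X n) - F z - p n \<bullet> (H z - H (X n)) - t * (1 + 2 * \<rho> * M\<^sup>2)) \<le> 0"
      by (simp add: G_def algebra_simps power2_eq_square)
    then have "F (X n) + p n \<bullet> H (X n) - t * (1 + 2 * \<rho> * M\<^sup>2) \<le> F z + p n \<bullet> H z"
      using t by (simp add: mult_le_0_iff inner_diff_right)
    moreover have "v \<le> F (X n) + p n \<bullet> H (X n) - (norm (p n - l))\<^sup>2 / (2 * \<rho>)"
      using v_le[OF X(1), of n] by (simp add: G_def aug_penalty_eq[OF K \<rho>] p_def)
    ultimately show ?thesis by (simp add: t_def)
  qed
  have "norm (p n) \<le> \<rho> * M + norm l" for n
  proof -
    have "infdist (H (X n) + (1 / \<rho>) *\<^sub>R l) (uminus ` K) \<le> norm (H (X n) + (1 / \<rho>) *\<^sub>R l)"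
      using infdist_le[of 0 "uminus ` K" "H (X n) + (1 / \<rho>) *\<^sub>R l"]
        image_eqI[of 0 uminus 0 K] convex_cone_contains_0[OF K(2)] by simp
    also have "\<dots> \<le> M + norm l / \<rho>"
      using norm_triangle_ineq[of "H (X n)" "(1 / \<rho>) *\<^sub>R l"] M[OF X(1), of n] \<rho> by simp
    finally have "\<rho> * infdist (H (X n) + (1 / \<rho>) *\<^sub>R l) (uminus ` K) \<le> \<rho> * (M + norm l / \<rho>)"
      using \<rho> by (intro mult_left_mono) auto
    then show ?thesis using \<rho> by (simp add: p_def norm_mult_update[OF K \<rho>] distrib_left)
  qed
  then have "range p \<subseteq> cball 0 (\<rho> * M + norm l) \<inter> dual_cone K" using pD by auto
  moreover have "compact (cball (0::'y) (\<rho> * M + norm l) \<inter> dual_cone K)"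
    by (intro compact_Int_closed compact_cball closed_dual_cone)
  ultimately obtain p' r where p': "p' \<in> dual_cone K" and r: "strict_mono r" "(p \<circ> r) \<longlonglongrightarrow> p'"
    unfolding compact_def by (metis IntD2 rangeI subset_iff)
  have er: "(\<lambda>n. e (r n)) \<longlonglongrightarrow> 0" using LIMSEQ_subseq_LIMSEQ[OF e0 r(1)] by (simp add: o_def)
  have pr: "(\<lambda>n. p (r n)) \<longlonglongrightarrow> p'" using r(2) by (simp add: o_def)
  \<comment> \<open>Strong duality: the proximal problem reaches the value \<open>v\<close> at the cluster point.\<close>
  have v_le': "v \<le> F z + p' \<bullet> H z - (norm (p' - l))\<^sup>2 / (2 * \<rho>)" if "z \<in> C" for z
  proof (rule LIMSEQ_le)
    show "(\<lambda>n. v - e (r n) * (1 + 2 * \<rho> * M\<^sup>2)) \<longlonglongrightarrow> v"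
      by (rule tendsto_eq_intros er refl | simp)+
    show "(\<lambda>n. F z + p (r n) \<bullet> H z - (norm (p (r n) - l))\<^sup>2 / (2 * \<rho>))
        \<longlonglongrightarrow> F z + p' \<bullet> H z - (norm (p' - l))\<^sup>2 / (2 * \<rho>)"
      using \<rho> by (intro tendsto_intros pr) auto
  qed (use key[OF that] in blast)
  show thesis
  proof
    show "p' \<in> dual_cone K" by (rule p')
    show "(norm (?P (H x) - p'))\<^sup>2 \<le> 2 * \<rho> * \<alpha>"
      if x: "x \<in> C" and near: "\<And>z. z \<in> C \<Longrightarrow> G x \<le> G z + \<alpha>" for x \<alpha>
    proof -
      have "G x - \<alpha> \<le> v"
        unfolding v_def using \<open>C \<noteq> {}\<close> near by (intro cINF_greatest) (auto simp: algebra_simps)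
      with v_le'[OF x] aug_penalty_ge[OF K \<rho> p', of "H x" l]
      have "(norm (p' - ?P (H x)))\<^sup>2 / (2 * \<rho>) \<le> \<alpha>" by (simp add: G_def)
      then show ?thesis using \<rho> by (simp add: field_simps norm_minus_commute)
    qed
    show "\<gamma> - (norm (q - l))\<^sup>2 / (2 * \<rho>) + (norm (q - p'))\<^sup>2 / (2 * \<rho>)
        \<le> F x + p' \<bullet> H x - (norm (p' - l))\<^sup>2 / (2 * \<rho>)"
      if q: "q \<in> dual_cone K" and \<gamma>: "\<And>z. z \<in> C \<Longrightarrow> \<gamma> \<le> F z + q \<bullet> H z" and x: "x \<in> C" for q \<gamma> x
    proof (rule order_trans[OF _ v_le'[OF x]], rule LIMSEQ_le)
      show "(\<lambda>n. \<gamma> - (norm (q - l))\<^sup>2 / (2 * \<rho>) + (norm (q - p (r n)))\<^sup>2 / (2 * \<rho>))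
          \<longlonglongrightarrow> \<gamma> - (norm (q - l))\<^sup>2 / (2 * \<rho>) + (norm (q - p'))\<^sup>2 / (2 * \<rho>)"
        using \<rho> by (intro tendsto_intros pr) auto
      show "(\<lambda>n. v + (e (r n))\<^sup>2) \<longlonglongrightarrow> v"
        by (rule tendsto_eq_intros er refl | simp)+
      have "\<gamma> - (norm (q - l))\<^sup>2 / (2 * \<rho>) + (norm (q - p n))\<^sup>2 / (2 * \<rho>) \<le> v + (e n)\<^sup>2" for n
        using \<gamma>[OF X(1), of n] X(2)[of n] aug_penalty_ge[OF K \<rho> q, of "H (X n)" l]
        by (simp add: p_def G_def)
      then show "\<exists>N. \<forall>n\<ge>N. \<gamma> - (norm (q - l))\<^sup>2 / (2 * \<rho>) + (norm (q - p (r n)))\<^sup>2 / (2 * \<rho>)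
          \<le> v + (e (r n))\<^sup>2" by blast
    qed
  qed
qed

text \<open>
  A proximal step for the perturbed dual function, taken from \<open>l\<close>, moves away from a maximizer \<open>\<mu>\<close>
  of the unperturbed one by at most \<open>\<rho>\<close> times the perturbation \<open>\<eta> \<mu>\<close> of the supergradients at \<open>\<mu>\<close>.

  The hypothesis compares supergradients in one direction only: each perturbed one is close to some
  unperturbed one, which at \<open>\<mu>\<close> itself need not be the supergradient \<open>0\<close> that certifies
  optimality. Hence it is applied at points \<open>q s = \<mu> + s (p - \<mu>)\<close> with \<open>s > 0\<close>. There every
  unperturbed supergradient is nonpositive in the direction \<open>d = p - \<mu>\<close>, because the concave dual
  function is maximal at \<open>s = 0\<close>, so the perturbed ones are at most \<open>\<eta> (q s) \<parallel>d\<parallel>\<close> in this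
  direction. Optimality of \<open>p\<close> bounds the same slope from below, and \<open>s \<rightarrow> 0\<close> turns
  \<open>\<eta> (q s)\<close> into \<open>\<eta> \<mu>\<close> by continuity.
\<close>
lemma proximal_step_to_dual_solution:
  fixes D :: "'y::real_inner set" and F F' :: "'x \<Rightarrow> real" and H H' :: "'x \<Rightarrow> 'y"
  assumes "convex D" "p \<in> D" "\<mu> \<in> D" and \<rho>: "0 < \<rho>"
    and prox: "\<And>q \<gamma> x. q \<in> D \<Longrightarrow> (\<And>z. z \<in> C \<Longrightarrow> \<gamma> \<le> F z + q \<bullet> H z) \<Longrightarrow> x \<in> C \<Longrightarrow>
           \<gamma> - (norm (q - l))\<^sup>2 / (2 * \<rho>) + (norm (q - p))\<^sup>2 / (2 * \<rho>)
             \<le> F x + p \<bullet> H x - (norm (p - l))\<^sup>2 / (2 * \<rho>)"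
    and dual_opt: "\<And>z. z \<in> C \<Longrightarrow> v \<le> F' z + \<mu> \<bullet> H' z"
    and primal: "y \<in> C" "F' y \<le> v" "\<And>q. q \<in> D \<Longrightarrow> q \<bullet> H' y \<le> 0"
    and near: "\<And>q. q \<in> D \<Longrightarrow> \<exists>x x'. x \<in> C \<and> x' \<in> C \<and> (\<forall>z\<in>C. F x + q \<bullet> H x \<le> F z + q \<bullet> H z) \<and>
        (\<forall>z\<in>C. F' x' + q \<bullet> H' x' \<le> F' z + q \<bullet> H' z) \<and> norm (H x - H' x') \<le> \<eta> q"
    and \<eta>: "continuous_on D \<eta>"
  shows "norm (p - \<mu>) \<le> norm (l - \<mu>) + \<rho> * \<eta> \<mu>"
proof -
  define d where "d = p - \<mu>"
  define q where "q = (\<lambda>s. \<mu> + s *\<^sub>R d)"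
  have qD: "q s \<in> D" if "0 \<le> s" "s \<le> 1" for s
    using convexD_alt[OF \<open>convex D\<close> \<open>\<mu> \<in> D\<close> \<open>p \<in> D\<close> that]
    by (simp add: q_def d_def algebra_simps)
  have bound: "(norm d)\<^sup>2 - (l - \<mu>) \<bullet> d \<le> \<rho> * (\<eta> (q s) * norm d)" if s: "0 < s" "s < 1" for s
  proof -
    obtain x x' where x: "x \<in> C" "\<And>z. z \<in> C \<Longrightarrow> F x + q s \<bullet> H x \<le> F z + q s \<bullet> H z"
      and x': "x' \<in> C" "\<And>z. z \<in> C \<Longrightarrow> F' x' + q s \<bullet> H' x' \<le> F' z + q s \<bullet> H' z"
      and xx': "norm (H x - H' x') \<le> \<eta> (q s)"
      using near[OF qD, of s] s by auto
    \<comment> \<open>Weak duality at \<open>q s\<close> through the feasible point \<open>y\<close>, against optimality of \<open>\<mu>\<close>.\<close>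
    have "s * (d \<bullet> H' x') \<le> 0"
      using x'(2)[OF primal(1)] primal(2) primal(3)[OF qD, of s] dual_opt[OF x'(1)] s
      by (simp add: q_def inner_add_left)
    then have "d \<bullet> H' x' \<le> 0" using s by (simp add: mult_le_0_iff)
    moreover have "d \<bullet> (H x - H' x') \<le> \<eta> (q s) * norm d"
      using norm_cauchy_schwarz[of d "H x - H' x'"] mult_right_mono[OF xx', of "norm d"]
      by (simp add: mult.commute)
    ultimately have u: "d \<bullet> H x \<le> \<eta> (q s) * norm d" by (simp add: inner_diff_right)
    \<comment> \<open>Maximality of \<open>p\<close> against \<open>q s\<close>, tested at a minimizer for \<open>q s\<close>.\<close>
    have "(norm (p - l))\<^sup>2 / (2 * \<rho>) + (norm (q s - p))\<^sup>2 / (2 * \<rho>) - (norm (q s - l))\<^sup>2 / (2 * \<rho>)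
        \<le> (p - q s) \<bullet> H x"
      using prox[OF qD x(2) x(1)] s by (simp add: inner_diff_left)
    also have "p - q s = (1 - s) *\<^sub>R d" by (simp add: q_def d_def algebra_simps)
    finally have "((norm (p - l))\<^sup>2 + (norm (q s - p))\<^sup>2 - (norm (q s - l))\<^sup>2) / (2 * \<rho>)
        \<le> (1 - s) * (d \<bullet> H x)"
      by (simp add: add_divide_distrib diff_divide_distrib)
    also have "(norm (p - l))\<^sup>2 + (norm (q s - p))\<^sup>2 - (norm (q s - l))\<^sup>2
        = 2 * (1 - s) * ((norm d)\<^sup>2 - (l - \<mu>) \<bullet> d)"
    proof -
      define w where "w = l - \<mu>"
      have eqs: "q s - p = (s - 1) *\<^sub>R d" "p - l = d - w" "q s - l = s *\<^sub>R d - w"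
        by (simp_all add: q_def d_def w_def algebra_simps)
      show ?thesis
        unfolding w_def[symmetric] eqs power2_norm_eq_inner
        by (simp add: inner_diff inner_commute algebra_simps power2_eq_square)
    qed
    finally have "(1 - s) * ((norm d)\<^sup>2 - (l - \<mu>) \<bullet> d) \<le> (1 - s) * (\<rho> * (d \<bullet> H x))"
      using \<rho> by (simp add: field_simps)
    then have "(norm d)\<^sup>2 - (l - \<mu>) \<bullet> d \<le> \<rho> * (d \<bullet> H x)"
      using s by (simp only: mult_le_cancel_left_pos)
    also have "\<dots> \<le> \<rho> * (\<eta> (q s) * norm d)" using u \<rho> by (intro mult_left_mono) auto
    finally show ?thesis .
  qed
  define s :: "nat \<Rightarrow> real" where "s = (\<lambda>n. 1 / real (Suc (Suc n)))"
  have s: "0 < s n" "s n < 1" for n by (auto simp: s_def)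
  have s0: "s \<longlonglongrightarrow> 0"
    unfolding s_def using LIMSEQ_Suc[OF LIMSEQ_inverse_real_of_nat] by (simp add: inverse_eq_divide)
  have "(\<lambda>n. q (s n)) \<longlonglongrightarrow> \<mu>"
    unfolding q_def by (rule tendsto_eq_intros s0 refl | simp)+
  then have "(\<lambda>n. \<eta> (q (s n))) \<longlonglongrightarrow> \<eta> \<mu>"
    using \<eta> \<open>\<mu> \<in> D\<close> qD s by (intro continuous_on_tendsto_compose[OF \<eta>]) (auto intro!: always_eventually less_imp_le)
  then have "(\<lambda>n. \<rho> * (\<eta> (q (s n)) * norm d)) \<longlonglongrightarrow> \<rho> * (\<eta> \<mu> * norm d)"
    by (intro tendsto_intros)
  then have "(norm d)\<^sup>2 - (l - \<mu>) \<bullet> d \<le> \<rho> * (\<eta> \<mu> * norm d)"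
    using bound s by (intro LIMSEQ_le_const) auto
  with norm_cauchy_schwarz[of "l - \<mu>" d]
  have "norm d * norm d \<le> (norm (l - \<mu>) + \<rho> * \<eta> \<mu>) * norm d"
    by (simp add: power2_eq_square algebra_simps)
  moreover have "0 \<le> norm (l - \<mu>) + \<rho> * \<eta> \<mu>"
  proof -
    obtain x x' where "norm (H x - H' x') \<le> \<eta> \<mu>" using near[OF \<open>\<mu> \<in> D\<close>] by blast
    then have "0 \<le> \<eta> \<mu>" using norm_ge_zero order_trans by blast
    then show ?thesis using \<rho> by simp
  qed
  ultimately show ?thesis
    by (cases "d = 0") (simp_all add: d_def)
qed

section \<open>The method with perturbed data\<close>

text \<open>
  The method in real-valued form: \<open>F0, H0\<close> are the objective and the constraint at the true
  parameter, \<open>F k, H k\<close> those used in step \<open>k\<close>, \<open>C\<close> is the part of the ground set where the objective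
  is finite, \<open>y0\<close> a feasible point with value \<open>v\<close>, and \<open>E k\<close> a bound for the parameter error.
  The assumption \<open>argmin_err\<close> compares supergradients of the dual functions, as
  \<open>proximal_step_to_dual_solution\<close> requires.
\<close>
locale perturbed_alm =
  fixes K :: "'y::euclidean_space set" and C :: "'x::real_vector set"
    and F0 :: "'x \<Rightarrow> real" and H0 :: "'x \<Rightarrow> 'y" and v :: real and y0 :: 'x
    and F :: "nat \<Rightarrow> 'x \<Rightarrow> real" and H :: "nat \<Rightarrow> 'x \<Rightarrow> 'y"
    and \<rho> \<alpha> E :: "nat \<Rightarrow> real" and \<eta> :: "'y \<Rightarrow> real" and Lf Lh :: real
    and x :: "nat \<Rightarrow> 'x" and lam :: "nat \<Rightarrow> 'y"
  assumes K: "closed K" "convex_cone K"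
    and primal: "y0 \<in> C" "F0 y0 = v" "- H0 y0 \<in> K"
    and F_convex: "\<And>k. convex_on C (F k)" and F_bdd: "\<And>k. bdd_below (F k ` C)"
    and H_affine: "\<And>k y z t. H k ((1 - t) *\<^sub>R y + t *\<^sub>R z) = (1 - t) *\<^sub>R H k y + t *\<^sub>R H k z"
    and H_bdd: "\<And>k. bounded (H k ` C)"
    and F_err: "\<And>k z. z \<in> C \<Longrightarrow> \<bar>F k z - F0 z\<bar> \<le> Lf * E k"
    and H_err: "\<And>k z. z \<in> C \<Longrightarrow> norm (H k z - H0 z) \<le> Lh * E k"
    and argmin_err: "\<And>k q. q \<in> dual_cone K \<Longrightarrow> \<exists>z z'. z \<in> C \<and> z' \<in> C \<and>
          (\<forall>w\<in>C. F k z + q \<bullet> H k z \<le> F k w + q \<bullet> H k w) \<and>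
          (\<forall>w\<in>C. F0 z' + q \<bullet> H0 z' \<le> F0 w + q \<bullet> H0 w) \<and>
          norm (H k z - H0 z') \<le> \<eta> q * E k"
    and \<eta>: "continuous_on (dual_cone K) \<eta>"
    and \<rho>: "\<And>k. 0 < \<rho> k" "(\<lambda>k. 1 / \<rho> k) \<longlonglongrightarrow> 0"
    and E: "E \<longlonglongrightarrow> 0" "summable (\<lambda>k. \<rho> k * E k)"
    and \<alpha>: "summable (\<lambda>k. sqrt (2 * \<alpha> k * \<rho> k))"
    and lam_0: "lam 0 \<in> dual_cone K"
    and x_in: "\<And>k. x (Suc k) \<in> C"
    and x_near_min: "\<And>k z. z \<in> C \<Longrightarrow>
          F k (x (Suc k)) + aug_penalty K (\<rho> k) (lam k) (H k (x (Suc k)))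
            \<le> F k z + aug_penalty K (\<rho> k) (lam k) (H k z) + \<alpha> k"
    and lam_Suc: "\<And>k. lam (Suc k) = mult_update K (\<rho> k) (lam k) (H k (x (Suc k)))"
begin

text \<open>
  The dual function at the true parameter reaches \<open>v\<close>, the value of the feasible point \<open>y0\<close>. Weak duality
  makes \<open>\<mu>\<close> a maximizer of the dual function and \<open>y0\<close> an optimal point.
\<close>
definition dual_solution :: "'y \<Rightarrow> bool" where
  "dual_solution \<mu> \<longleftrightarrow> \<mu> \<in> dual_cone K \<and> (\<forall>z\<in>C. v \<le> F0 z + \<mu> \<bullet> H0 z)"

definition step_err :: "'y \<Rightarrow> nat \<Rightarrow> real" where
  "step_err \<mu> k = sqrt (2 * \<alpha> k * \<rho> k) + \<rho> k * E k * \<eta> \<mu>"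

definition radius :: "'y \<Rightarrow> real" where
  "radius \<mu> = (\<Sum>k. sqrt (2 * \<alpha> k * \<rho> k)) + (\<Sum>k. \<rho> k * E k) * \<eta> \<mu> + norm (lam 0 - \<mu>)"

lemma lam_in: "lam k \<in> dual_cone K"
  by (cases k) (auto simp: lam_0 lam_Suc mult_update_in_dual_cone[OF K \<rho>(1)])

lemma C_ne: "C \<noteq> {}" using primal(1) by auto

lemma \<alpha>_nonneg: "0 \<le> \<alpha> k"
  using x_near_min[OF x_in, of k k] by simp

lemma feasible_inner_nonpos: "q \<in> dual_cone K \<Longrightarrow> q \<bullet> H0 y0 \<le> 0"
  using primal(3) unfolding dual_cone_def by force

lemma err_nonneg: "0 \<le> Lf * E k"
  using F_err[OF primal(1), of k] by (meson abs_ge_zero order_trans)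

lemma step_err_nonneg:
  assumes "\<mu> \<in> dual_cone K" shows "0 \<le> step_err \<mu> k"
proof -
  obtain z z' where "norm (H k z - H0 z') \<le> \<eta> \<mu> * E k" using argmin_err[OF assms] by blast
  then have "0 \<le> \<eta> \<mu> * E k" using norm_ge_zero order_trans by blast
  then have "0 \<le> \<rho> k * (\<eta> \<mu> * E k)" using \<rho>(1)[of k] by simp
  then show ?thesis using \<alpha>_nonneg[of k] \<rho>(1)[of k] by (simp add: step_err_def mult.commute mult.left_commute)
qed

lemma step_err_summable: "summable (step_err \<mu>)"
  unfolding step_err_def by (intro summable_add summable_mult2 \<alpha> E)

lemma radius_eq: "radius \<mu> = norm (lam 0 - \<mu>) + (\<Sum>k. step_err \<mu> k)"
proof -
  have "(\<Sum>k. step_err \<mu> k) = (\<Sum>k. sqrt (2 * \<alpha> k * \<rho> k)) + (\<Sum>k. \<rho> k * E k * \<eta> \<mu>)"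
    unfolding step_err_def by (intro suminf_add[symmetric] summable_mult2 \<alpha> E)
  also have "(\<Sum>k. \<rho> k * E k * \<eta> \<mu>) = (\<Sum>k. \<rho> k * E k) * \<eta> \<mu>"
    by (intro suminf_mult2[symmetric] E)
  finally show ?thesis by (simp add: radius_def)
qed

text \<open>
  The new multiplier is close to an exact proximal point \<open>p\<close> of the perturbed dual function. This
  point is controlled in two ways, by its distance to the dual solutions and by the dual value it
  reaches.
\<close>
lemma multiplier_step:
  obtains p where "norm (lam (Suc k) - p) \<le> sqrt (2 * \<alpha> k * \<rho> k)"
    and "\<And>\<mu>. dual_solution \<mu> \<Longrightarrow> norm (p - \<mu>) \<le> norm (lam k - \<mu>) + \<rho> k * E k * \<eta> \<mu>"
    and "\<And>\<mu> z. dual_solution \<mu> \<Longrightarrow> z \<in> C \<Longrightarrow>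
           v - (2 * Lf + norm \<mu> * Lh) * E k - (norm (\<mu> - lam k))\<^sup>2 / (2 * \<rho> k) \<le> F0 z + p \<bullet> H k z"
proof -
  obtain p where p: "p \<in> dual_cone K"
    and near: "\<And>z \<alpha>. z \<in> C \<Longrightarrow>
          (\<And>w. w \<in> C \<Longrightarrow> F k z + aug_penalty K (\<rho> k) (lam k) (H k z)
             \<le> F k w + aug_penalty K (\<rho> k) (lam k) (H k w) + \<alpha>) \<Longrightarrow>
           (norm (mult_update K (\<rho> k) (lam k) (H k z) - p))\<^sup>2 \<le> 2 * \<rho> k * \<alpha>"
    and prox: "\<And>q \<gamma> z. q \<in> dual_cone K \<Longrightarrow> (\<And>w. w \<in> C \<Longrightarrow> \<gamma> \<le> F k w + q \<bullet> H k w) \<Longrightarrow> z \<in> C \<Longrightarrow>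
           \<gamma> - (norm (q - lam k))\<^sup>2 / (2 * \<rho> k) + (norm (q - p))\<^sup>2 / (2 * \<rho> k)
             \<le> F k z + p \<bullet> H k z - (norm (p - lam k))\<^sup>2 / (2 * \<rho> k)"
    using proximal_multiplier[OF K \<rho>(1) F_convex F_bdd C_ne H_affine H_bdd] by metis
  show thesis
  proof
    show "norm (lam (Suc k) - p) \<le> sqrt (2 * \<alpha> k * \<rho> k)"
      using near[OF x_in x_near_min] by (intro real_le_rsqrt) (simp add: lam_Suc mult_ac)
  next
    fix \<mu> assume \<mu>: "dual_solution \<mu>"
    have "norm (p - \<mu>) \<le> norm (lam k - \<mu>) + \<rho> k * (\<eta> \<mu> * E k)"
    proof (rule proximal_step_to_dual_solution[where D = "dual_cone K" and C = C and F = "F k"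
          and H = "H k" and F' = F0 and H' = H0 and v = v and y = y0 and \<eta> = "\<lambda>q. \<eta> q * E k"])
      show "\<mu> \<in> dual_cone K" "\<And>z. z \<in> C \<Longrightarrow> v \<le> F0 z + \<mu> \<bullet> H0 z"
        using \<mu> by (auto simp: dual_solution_def)
      show "continuous_on (dual_cone K) (\<lambda>q. \<eta> q * E k)" by (intro continuous_intros \<eta>)
      show "F0 y0 \<le> v" by (simp add: primal)
    qed (fact convex_dual_cone p \<rho> prox primal feasible_inner_nonpos argmin_err)+
    then show "norm (p - \<mu>) \<le> norm (lam k - \<mu>) + \<rho> k * E k * \<eta> \<mu>" by (simp add: mult_ac)
  next
    fix \<mu> z assume \<mu>: "dual_solution \<mu>" and z: "z \<in> C"
    have "v - (Lf + norm \<mu> * Lh) * E k \<le> F k w + \<mu> \<bullet> H k w" if w: "w \<in> C" for w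
    proof -
      have "\<mu> \<bullet> (H0 w - H k w) \<le> norm \<mu> * (Lh * E k)"
        using norm_cauchy_schwarz[of \<mu> "H0 w - H k w"] H_err[OF w, of k]
          mult_left_mono[OF H_err[OF w, of k], of "norm \<mu>"] by (simp add: norm_minus_commute)
      moreover have "v \<le> F0 w + \<mu> \<bullet> H0 w" using \<mu> w by (simp add: dual_solution_def)
      ultimately show ?thesis using F_err[OF w, of k] by (simp add: inner_diff_right algebra_simps)
    qed
    from prox[OF _ this z] \<mu>
    have "v - (Lf + norm \<mu> * Lh) * E k - (norm (\<mu> - lam k))\<^sup>2 / (2 * \<rho> k)
        + (norm (\<mu> - p))\<^sup>2 / (2 * \<rho> k) \<le> F k z + p \<bullet> H k z - (norm (p - lam k))\<^sup>2 / (2 * \<rho> k)"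
      by (simp add: dual_solution_def)
    moreover have "0 \<le> (norm (\<mu> - p))\<^sup>2 / (2 * \<rho> k)" "0 \<le> (norm (p - lam k))\<^sup>2 / (2 * \<rho> k)"
      using \<rho>(1)[of k] by auto
    moreover have "F k z \<le> F0 z + Lf * E k" using F_err[OF z, of k] by simp
    ultimately show "v - (2 * Lf + norm \<mu> * Lh) * E k - (norm (\<mu> - lam k))\<^sup>2 / (2 * \<rho> k)
        \<le> F0 z + p \<bullet> H k z"
      by (simp add: distrib_right)
  qed
qed

lemma lam_quasi_fejer:
  assumes "dual_solution \<mu>"
  shows "norm (lam (Suc k) - \<mu>) \<le> norm (lam k - \<mu>) + step_err \<mu> k"
proof (rule multiplier_step[of k])
  fix p assume "norm (lam (Suc k) - p) \<le> sqrt (2 * \<alpha> k * \<rho> k)"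
    and "\<And>\<mu>. dual_solution \<mu> \<Longrightarrow> norm (p - \<mu>) \<le> norm (lam k - \<mu>) + \<rho> k * E k * \<eta> \<mu>"
  with assms norm_triangle_ineq[of "lam (Suc k) - p" "p - \<mu>"] show ?thesis
    by (fastforce simp: step_err_def)
qed

lemma lam_dist_le_radius:
  assumes "dual_solution \<mu>"
  shows "norm (lam k - \<mu>) \<le> radius \<mu>"
  using quasi_fejer_bound[of "\<lambda>k. norm (lam k - \<mu>)" "step_err \<mu>" 0 k] lam_quasi_fejer[OF assms]
    step_err_nonneg[of \<mu>] step_err_summable assms
  by (simp add: radius_eq dual_solution_def)

text \<open>
  Proximal points are nearly maximal: comparing with a fixed dual solution costs \<open>O(1 / \<rho> k)\<close> for the
  proximal term and \<open>O(E k)\<close> for the perturbation, and both vanish.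
\<close>
lemma cluster_point_dual_solution:
  assumes \<mu>: "dual_solution \<mu>" and r: "strict_mono r" "(\<lambda>j. lam (Suc (r j))) \<longlonglongrightarrow> l"
  shows "dual_solution l"
  unfolding dual_solution_def
proof (intro conjI ballI)
  show "l \<in> dual_cone K"
    using closed_sequentially[OF closed_dual_cone _ r(2)] lam_in by blast
next
  fix z assume z: "z \<in> C"
  define Q where "Q = (\<lambda>k p. norm (lam (Suc k) - p) \<le> sqrt (2 * \<alpha> k * \<rho> k) \<and>
    v - (2 * Lf + norm \<mu> * Lh) * E k - (norm (\<mu> - lam k))\<^sup>2 / (2 * \<rho> k) \<le> F0 z + p \<bullet> H k z)"
  have "\<exists>p. Q k p" for k
    unfolding Q_def by (rule multiplier_step[of k]) (use \<mu> z in blast)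
  then obtain p where p: "\<And>k. Q k (p k)" by metis
  have sub: "(\<lambda>j. u (r j)) \<longlonglongrightarrow> a" if "u \<longlonglongrightarrow> a" for u :: "nat \<Rightarrow> 'c::topological_space" and a
    using LIMSEQ_subseq_LIMSEQ[OF that r(1)] by (simp add: o_def)
  have "(\<lambda>k. lam (Suc k) - p k) \<longlonglongrightarrow> 0"
    by (rule Lim_null_comparison[OF _ summable_LIMSEQ_zero[OF \<alpha>]]) (use p in \<open>auto simp: Q_def\<close>)
  from tendsto_diff[OF r(2) sub[OF this]] have p_lim: "(\<lambda>j. p (r j)) \<longlonglongrightarrow> l" by simp
  have "(\<lambda>k. H k z - H0 z) \<longlonglongrightarrow> 0"
    by (rule Lim_null_comparison[OF always_eventually[OF allI[OF H_err[OF z]]]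
          tendsto_mult_right_zero[OF E(1)]])
  then have "(\<lambda>k. H k z) \<longlonglongrightarrow> H0 z" by (simp add: LIM_zero_iff)
  from tendsto_add[OF tendsto_const tendsto_inner[OF p_lim sub[OF this]]]
  have rhs: "(\<lambda>j. F0 z + p (r j) \<bullet> H (r j) z) \<longlonglongrightarrow> F0 z + l \<bullet> H0 z" .
  have le: "norm ((norm (\<mu> - lam k))\<^sup>2 / (2 * \<rho> k)) \<le> (radius \<mu>)\<^sup>2 / 2 * (1 / \<rho> k)" for k
    using power_mono[OF lam_dist_le_radius[OF \<mu>, of k], of 2] \<rho>(1)[of k]
    by (simp add: norm_minus_commute divide_right_mono)
  have "(\<lambda>k. (norm (\<mu> - lam k))\<^sup>2 / (2 * \<rho> k)) \<longlonglongrightarrow> 0"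
    by (rule Lim_null_comparison[OF always_eventually[OF allI[OF le]]
          tendsto_mult_right_zero[OF \<rho>(2)]])
  from tendsto_diff[OF tendsto_diff[OF tendsto_const tendsto_mult_right_zero[OF E(1)]] this]
  have "(\<lambda>k. v - (2 * Lf + norm \<mu> * Lh) * E k - (norm (\<mu> - lam k))\<^sup>2 / (2 * \<rho> k)) \<longlonglongrightarrow> v"
    by simp
  from LIMSEQ_le[OF sub[OF this] rhs] p show "v \<le> F0 z + l \<bullet> H0 z"
    by (auto simp: Q_def)
qed

text \<open>
  The Opial argument: distances to every dual solution are quasi-Fejer, and a cluster point is itself
  a dual solution, so the distance to it tends to zero along the whole sequence.
\<close>
theorem lam_converges:
  assumes "\<exists>\<mu>. dual_solution \<mu>"
  obtains l where "dual_solution l" "lam \<longlonglongrightarrow> l"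
proof -
  obtain \<mu> where \<mu>: "dual_solution \<mu>" using assms by blast
  have "lam (Suc k) \<in> cball \<mu> (radius \<mu>)" for k
    using lam_dist_le_radius[OF \<mu>] by (simp add: dist_norm norm_minus_commute)
  then obtain l r where r: "strict_mono r" "((\<lambda>k. lam (Suc k)) \<circ> r) \<longlonglongrightarrow> l"
    using compact_cball[of \<mu> "radius \<mu>"] unfolding compact_def by metis
  then have lim: "(\<lambda>j. lam (Suc (r j))) \<longlonglongrightarrow> l" by (simp add: o_def)
  have l: "dual_solution l" by (rule cluster_point_dual_solution[OF \<mu> r(1) lim])
  have "(\<lambda>k. norm (lam k - l)) \<longlonglongrightarrow> 0"
  proof (rule quasi_fejer_tendsto_0)
    show "strict_mono (\<lambda>j. Suc (r j))" using r(1) by (simp add: strict_mono_def)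
    show "(\<lambda>j. norm (lam (Suc (r j)) - l)) \<longlonglongrightarrow> 0"
      using lim by (simp add: LIM_zero_iff tendsto_norm_zero_iff)
  qed (use l lam_quasi_fejer step_err_nonneg step_err_summable in \<open>auto simp: dual_solution_def\<close>)
  then have "lam \<longlonglongrightarrow> l" by (simp add: LIM_zero_iff tendsto_norm_zero_iff)
  with l that show thesis by blast
qed

lemma infeasibility_bound:
  assumes \<mu>: "dual_solution \<mu>"
  shows "infdist (H0 (x (Suc k))) (uminus ` K) \<le> 2 * radius \<mu> / \<rho> k + Lh * E k"
proof -
  let ?y = "x (Suc k)"
  have "infdist (H0 ?y) (uminus ` K) \<le> infdist (H k ?y) (uminus ` K) + dist (H0 ?y) (H k ?y)"
    by (rule infdist_triangle)
  moreover have "dist (H0 ?y) (H k ?y) \<le> Lh * E k"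
    using H_err[OF x_in, of k k] by (simp add: dist_norm norm_minus_commute)
  moreover have "infdist (H k ?y) (uminus ` K) \<le> norm (lam (Suc k) - lam k) / \<rho> k"
    using mult_update_residual[OF K \<rho>(1)] by (simp add: lam_Suc)
  moreover have "norm (lam (Suc k) - lam k) / \<rho> k \<le> 2 * radius \<mu> / \<rho> k"
  proof (rule divide_right_mono)
    show "norm (lam (Suc k) - lam k) \<le> 2 * radius \<mu>"
      using norm_triangle_ineq4[of "lam (Suc k) - \<mu>" "lam k - \<mu>"]
        lam_dist_le_radius[OF \<mu>, of k] lam_dist_le_radius[OF \<mu>, of "Suc k"] by simp
  qed (simp add: \<rho> less_imp_le)
  ultimately show ?thesis by simp
qed

text \<open>
  Compares \<open>x (Suc k)\<close> with \<open>y0\<close> in the augmented Lagrangian, whose penalty at \<open>y0\<close> is small because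
  \<open>y0\<close> is feasible for the true parameter.
\<close>
lemma objective_upper_bound:
  "F0 (x (Suc k)) - v \<le> \<alpha> k + 2 * (Lf * E k) + \<rho> k * (Lh * E k)\<^sup>2 + (norm (lam k))\<^sup>2 / \<rho> k"
proof -
  let ?y = "x (Suc k)" and ?d = "\<lambda>z. infdist (H k z + (1 / \<rho> k) *\<^sub>R lam k) (uminus ` K)"
  note [simp] = \<rho>(1)[of k]
  have "F k ?y + \<rho> k / 2 * (?d ?y)\<^sup>2 \<le> F k y0 + \<rho> k / 2 * (?d y0)\<^sup>2 + \<alpha> k"
    using x_near_min[OF primal(1), of k] by (simp add: aug_penalty_def)
  moreover have "0 \<le> \<rho> k / 2 * (?d ?y)\<^sup>2" by (simp add: less_imp_le)
  moreover have "\<rho> k / 2 * (?d y0)\<^sup>2 \<le> \<rho> k * (Lh * E k)\<^sup>2 + (norm (lam k))\<^sup>2 / \<rho> k"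
  proof -
    let ?w = "H k y0 + (1 / \<rho> k) *\<^sub>R lam k"
    have "H0 y0 \<in> uminus ` K" using primal(3) by (metis imageI minus_minus)
    then have "?d y0 \<le> norm ((H k y0 - H0 y0) + (1 / \<rho> k) *\<^sub>R lam k)"
      using infdist_le[of "H0 y0" "uminus ` K" ?w] by (simp add: dist_norm algebra_simps)
    also have "\<dots> \<le> Lh * E k + norm (lam k) / \<rho> k"
      using norm_triangle_ineq[of "H k y0 - H0 y0" "(1 / \<rho> k) *\<^sub>R lam k"] H_err[OF primal(1), of k]
      by (simp add: less_imp_le)
    finally have "(?d y0)\<^sup>2 \<le> (Lh * E k + norm (lam k) / \<rho> k)\<^sup>2"
      by (intro power_mono infdist_nonneg)
    also have "\<dots> \<le> 2 * (Lh * E k)\<^sup>2 + 2 * (norm (lam k) / \<rho> k)\<^sup>2"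
      using sum_squares_bound[of "Lh * E k" "norm (lam k) / \<rho> k"] by (simp add: power2_sum)
    finally have "\<rho> k / 2 * (?d y0)\<^sup>2 \<le> \<rho> k / 2 * (2 * (Lh * E k)\<^sup>2 + 2 * (norm (lam k) / \<rho> k)\<^sup>2)"
      by (intro mult_left_mono) (auto simp: less_imp_le)
    also have "\<dots> = \<rho> k * (Lh * E k)\<^sup>2 + (norm (lam k))\<^sup>2 / \<rho> k"
      using \<rho>(1)[of k] by (simp add: field_simps power2_eq_square)
    finally show ?thesis .
  qed
  moreover have "F k y0 \<le> v + Lf * E k" using F_err[OF primal(1), of k] primal(2) by simp
  moreover have "F0 ?y \<le> F k ?y + Lf * E k" using F_err[OF x_in, of k k] by simp
  ultimately show ?thesis by linarith
qed

text \<open>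
  A point can beat the optimal value only by being infeasible, at the price \<open>\<mu>\<close>.
\<close>
lemma objective_lower_bound:
  assumes \<mu>: "dual_solution \<mu>" and z: "z \<in> C"
  shows "v - F0 z \<le> norm \<mu> * infdist (H0 z) (uminus ` K)"
proof -
  define c where "c = closest_point (dual_cone K) (H0 z)"
  have "\<mu> \<bullet> (H0 z - c) \<le> 0"
    unfolding c_def using \<mu> by (intro moreau_decomposition(2)[OF K]) (simp add: dual_solution_def)
  then have "\<mu> \<bullet> H0 z \<le> norm \<mu> * norm c"
    using norm_cauchy_schwarz[of \<mu> c] by (simp add: inner_diff_right)
  moreover have "v \<le> F0 z + \<mu> \<bullet> H0 z" using \<mu> z by (simp add: dual_solution_def)
  ultimately show ?thesis by (simp add: infdist_neg_cone[OF K] c_def)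
qed

lemma objective_bound:
  assumes \<mu>: "dual_solution \<mu>" and Lh: "Lh \<noteq> 0"
  shows "\<bar>F0 (x (Suc k)) - v\<bar> \<le> \<alpha> k + (2 * radius \<mu> + norm \<mu>)\<^sup>2 / \<rho> k
           + \<rho> k * (Lh * E k + Lf / (\<rho> k * Lh))\<^sup>2"
proof -
  let ?R = "radius \<mu>" and ?m = "norm \<mu>" and ?d = "Lh * E k"
  have \<rho>k: "0 < \<rho> k" by (rule \<rho>)
  have R: "0 \<le> ?R" using lam_dist_le_radius[OF \<mu>, of 0] norm_ge_zero order_trans by blast
  have sq: "\<rho> k * (?d + Lf / (\<rho> k * Lh))\<^sup>2 = \<rho> k * ?d\<^sup>2 + 2 * (Lf * E k) + Lf\<^sup>2 / (\<rho> k * Lh\<^sup>2)"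
    using \<rho>k Lh by (simp add: field_simps power2_eq_square)
  have "0 \<le> Lf\<^sup>2 / (\<rho> k * Lh\<^sup>2)" using \<rho>k by simp
  then have sq_ge: "\<rho> k * ?d\<^sup>2 + 2 * (Lf * E k) \<le> \<rho> k * (?d + Lf / (\<rho> k * Lh))\<^sup>2"
    by (simp add: sq)
  have "norm (lam k) \<le> 2 * ?R + ?m"
    using norm_triangle_ineq[of "lam k - \<mu>" \<mu>] lam_dist_le_radius[OF \<mu>, of k] R by simp
  then have "(norm (lam k))\<^sup>2 / \<rho> k \<le> (2 * ?R + ?m)\<^sup>2 / \<rho> k"
    using \<rho>k by (intro divide_right_mono power_mono) auto
  with objective_upper_bound[of k] sq_ge
  have "F0 (x (Suc k)) - v \<le> \<alpha> k + (2 * ?R + ?m)\<^sup>2 / \<rho> k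
      + \<rho> k * (?d + Lf / (\<rho> k * Lh))\<^sup>2" by linarith
  moreover have "v - F0 (x (Suc k)) \<le> (2 * ?R + ?m)\<^sup>2 / \<rho> k + \<rho> k * ?d\<^sup>2"
  proof -
    have "v - F0 (x (Suc k)) \<le> ?m * (2 * ?R / \<rho> k + ?d)"
      using objective_lower_bound[OF \<mu> x_in, of k]
        mult_left_mono[OF infeasibility_bound[OF \<mu>, of k] norm_ge_zero[of \<mu>]] by simp
    also have "\<dots> \<le> (2 * ?R + ?m)\<^sup>2 / \<rho> k + \<rho> k * ?d\<^sup>2"
    proof -
      \<comment> \<open>The difference of the two sides, times \<open>2 * \<rho> k\<close>, as a sum of nonnegative terms.\<close>
      have "0 \<le> (?m - \<rho> k * ?d)\<^sup>2 + ?m\<^sup>2 + (\<rho> k * ?d)\<^sup>2 + 8 * ?R\<^sup>2 + 4 * (?R * ?m)" using R by simp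
      also have "\<dots> = 2 * \<rho> k * ((2 * ?R + ?m)\<^sup>2 / \<rho> k + \<rho> k * ?d\<^sup>2 - ?m * (2 * ?R / \<rho> k + ?d))"
        using \<rho>k by (simp add: field_simps power2_eq_square)
      finally show ?thesis using \<rho>k by (simp add: zero_le_mult_iff)
    qed
    finally show ?thesis .
  qed
  ultimately show ?thesis
    using sq_ge err_nonneg[of k] \<alpha>_nonneg[of k] by (simp add: abs_le_iff)
qed

end

section \<open>Convergence and rates\<close>

theorem theorem7:
  fixes X :: "(real ^ 'n) set" and \<Theta> :: "(real ^ 'd) set" and K :: "(real ^ 'm) set"
    and f :: "real ^ 'n \<Rightarrow> real ^ 'd \<Rightarrow> ereal"
    and h :: "real ^ 'n \<Rightarrow> real ^ 'd \<Rightarrow> real ^ 'm"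
    and A :: "real ^ 'd \<Rightarrow> real ^ 'n ^ 'm" and b :: "real ^ 'd \<Rightarrow> real ^ 'm"
    and \<theta>s :: "real ^ 'd" and fs :: real
    and L\<^sub>A L\<^sub>b L\<^sub>f :: real and \<kappa> :: "real ^ 'm \<Rightarrow> real"
    and \<theta> :: "nat \<Rightarrow> real ^ 'd" and x :: "nat \<Rightarrow> real ^ 'n" and lam :: "nat \<Rightarrow> real ^ 'm"
    and \<alpha> \<rho> :: "nat \<Rightarrow> real" and \<alpha>0 \<rho>0 c \<beta> \<tau> \<delta> :: real
    and D\<^sub>x L\<^sub>h\<^sub>\<theta> L\<^sub>h\<^sub>x :: real and \<kappa>\<^sub>d C' :: "real ^ 'm \<Rightarrow> real"
    and B :: "real ^ 'm \<Rightarrow> nat \<Rightarrow> real"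
  assumes K: "closed K" "convex_cone K"
    and X: "convex X" "compact X"
    and \<Theta>: "convex \<Theta>" "compact \<Theta>"
    and \<theta>s: "\<theta>s \<in> \<Theta>"
    and f_range: "\<And>y \<theta>'. \<theta>' \<in> \<Theta> \<Longrightarrow> f y \<theta>' \<noteq> -\<infinity>"
    \<comment> \<open>finite attained optimal value, dual solution, no duality gap (at the true parameter)\<close>
    and opt: "opt_value X K f h \<theta>s = ereal fs"
    and opt_attained: "\<exists>y\<in>feasible X K h \<theta>s. f y \<theta>s = ereal fs"
    and dual_sol: "\<exists>l. is_arg_max (\<lambda>l. dual_fun X K f h 0 l \<theta>s) (\<lambda>_. True) l"
    and no_gap: "(SUP l. dual_fun X K f h 0 l \<theta>s) = opt_value X K f h \<theta>s"
    \<comment> \<open>affine constraints, Lipschitz at the true parameter in the spectral norm\<close>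
    and h: "\<And>y \<theta>'. \<theta>' \<in> \<Theta> \<Longrightarrow> h y \<theta>' = A \<theta>' *v y + b \<theta>'"
    and A_lip: "\<And>\<theta>'. \<theta>' \<in> \<Theta> \<Longrightarrow> onorm ((*v) (A \<theta>' - A \<theta>s)) \<le> L\<^sub>A * norm (\<theta>' - \<theta>s)"
    and b_lip: "\<And>\<theta>'. \<theta>' \<in> \<Theta> \<Longrightarrow> norm (b \<theta>' - b \<theta>s) \<le> L\<^sub>b * norm (\<theta>' - \<theta>s)"
    and A_cont: "continuous_on \<Theta> (\<lambda>\<theta>'. onorm ((*v) (A \<theta>')))"
    and f_convex: "\<And>\<theta>'. \<theta>' \<in> \<Theta> \<Longrightarrow> ereal_convex_on X (\<lambda>y. f y \<theta>')"
    \<comment> \<open>the bound on the absolute difference, split so that it makes sense where f is infinite\<close>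
    and f_lip: "\<And>\<theta>' y. \<theta>' \<in> \<Theta> \<Longrightarrow> y \<in> X \<Longrightarrow>
        f y \<theta>' \<le> f y \<theta>s + ereal (L\<^sub>f * norm (\<theta>' - \<theta>s)) \<and>
        f y \<theta>s \<le> f y \<theta>' + ereal (L\<^sub>f * norm (\<theta>' - \<theta>s))"
    and \<kappa>: "continuous_on (dual_cone K) \<kappa>" "\<And>l. l \<in> dual_cone K \<Longrightarrow> 0 < \<kappa> l"
    \<comment> \<open>existence of the minimizers, which automatically holds for lower semicontinuous f\<close>
    and argmin_nonempty: "\<And>l \<theta>'. l \<in> dual_cone K \<Longrightarrow> \<theta>' \<in> \<Theta> \<Longrightarrow> lagr_argmin X K f h l \<theta>' \<noteq> {}"
    and argmin_lip: "\<And>l \<theta>'. l \<in> dual_cone K \<Longrightarrow> \<theta>' \<in> \<Theta> \<Longrightarrow>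
        lagr_argmin X K f h l \<theta>'
          \<subseteq> lagr_argmin X K f h l \<theta>s + (*\<^sub>R) (\<kappa> l * norm (\<theta>' - \<theta>s)) ` cball 0 1"
    and \<theta>: "\<And>k. \<theta> k \<in> \<Theta>" "\<And>k. norm (\<theta> k - \<theta>s) \<le> \<tau> ^ k * norm (\<theta> 0 - \<theta>s)"
    and params: "0 < \<tau>" "\<tau> < 1" "0 < c" "0 < \<alpha>0" "0 < \<rho>0" "1 < \<beta>" "\<delta> = \<beta> * \<tau>" "\<delta> < 1"
    and \<alpha>: "\<And>k. \<alpha> k = \<alpha>0 * real (k + 1) powr (- 2 * (1 + c)) / \<beta> ^ k"
    and \<rho>: "\<And>k. \<rho> k = \<rho>0 * \<beta> ^ k"
    and ipalm: "ipalm X K f h \<rho> \<alpha> \<theta> x lam"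
    \<comment> \<open>abbreviations used in the conclusion; the suprema are maxima\<close>
    and D\<^sub>x: "D\<^sub>x = (SUP y\<in>X. norm y)"
    and L\<^sub>h\<^sub>\<theta>: "L\<^sub>h\<^sub>\<theta> = L\<^sub>A * D\<^sub>x + L\<^sub>b"
    and L\<^sub>h\<^sub>x: "L\<^sub>h\<^sub>x = (SUP \<theta>'\<in>\<Theta>. onorm ((*v) (A \<theta>')))"
    and \<kappa>\<^sub>d: "\<And>l. \<kappa>\<^sub>d l = L\<^sub>h\<^sub>\<theta> + \<kappa> l * L\<^sub>h\<^sub>x"
    and C': "\<And>l. C' l = (\<Sum>i. sqrt (2 * \<alpha> i * \<rho> i))
              + \<rho>0 * \<kappa>\<^sub>d l * norm (\<theta> 0 - \<theta>s) / (1 - \<beta> * \<tau>) + norm (lam 0 - l)"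
    and B: "\<And>l k. B l k = \<alpha>0 / real (k + 1) powr (2 * (1 + c))
              + 1 / \<rho>0 * (2 * C' l + norm l)\<^sup>2
              + \<rho>0 * (L\<^sub>h\<^sub>\<theta> * norm (\<theta> 0 - \<theta>s) * \<delta> ^ k + L\<^sub>f / (\<rho>0 * L\<^sub>h\<^sub>\<theta>))\<^sup>2"
  shows "\<exists>ls. (\<lambda>k. (1 / real k) *\<^sub>R (\<Sum>i=1..k. lam i)) \<longlonglongrightarrow> ls \<and>
           is_arg_max (\<lambda>l. dual_fun X K f h 0 l \<theta>s) (\<lambda>_. True) ls \<and>
           \<comment> \<open>B divides by the constant required to be nonzero here\<close>
           (L\<^sub>h\<^sub>\<theta> \<noteq> 0 \<longrightarrow> (\<forall>k. \<bar>f (x (Suc k)) \<theta>s - ereal fs\<bar> \<le> ereal (B ls k / \<beta> ^ k))) \<and>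
           (\<forall>k. infdist (h (x (Suc k)) \<theta>s) (uminus ` K)
                  \<le> 1 / \<beta> ^ k * (2 * C' ls / \<rho>0 + L\<^sub>h\<^sub>\<theta> * norm (\<theta> 0 - \<theta>s) * \<delta> ^ k))"
proof -
  \<comment> \<open>By the Lipschitz bound the objective is finite at the same points for all parameters.\<close>
  define C where "C = {y \<in> X. f y \<theta>s \<noteq> \<infinity>}"
  define F where "F = (\<lambda>\<theta>' y. real_of_ereal (f y \<theta>'))"
  define e where "e = norm (\<theta> 0 - \<theta>s)"
  \<comment> \<open>The geometric majorant, not the error itself, so that the sum of \<open>\<rho> k * E k\<close> is exactly
     the geometric series in the asserted constant.\<close>
  define E where "E = (\<lambda>k. \<tau> ^ k * e)"
  obtain y0 where y0: "y0 \<in> X" "- h y0 \<theta>s \<in> K" "f y0 \<theta>s = ereal fs"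
    using opt_attained by (auto simp: feasible_def)
  have y0C: "y0 \<in> C" using y0 by (simp add: C_def)
  have CX: "y \<in> X" if "y \<in> C" for y using that by (simp add: C_def)
  have f_C: "f y \<theta>' = ereal (F \<theta>' y)" if "\<theta>' \<in> \<Theta>" "y \<in> C" for y \<theta>'
  proof -
    have "f y \<theta>' \<noteq> \<infinity>" using f_lip[OF that(1) CX[OF that(2)]] that(2) f_range[OF \<theta>s, of y]
      by (cases "f y \<theta>s") (auto simp: C_def)
    then show ?thesis using f_range[OF that(1), of y] by (cases "f y \<theta>'") (auto simp: F_def)
  qed
  have f_not_C: "f y \<theta>' = \<infinity>" if "\<theta>' \<in> \<Theta>" "y \<in> X" "y \<notin> C" for y \<theta>'
    using f_lip[OF that(1,2)] that(2,3) by (cases "f y \<theta>'") (auto simp: C_def)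
  have F_lip: "\<bar>F \<theta>' y - F \<theta>s y\<bar> \<le> L\<^sub>f * norm (\<theta>' - \<theta>s)" if "\<theta>' \<in> \<Theta>" "y \<in> C" for y \<theta>'
    using f_lip[OF that(1) CX[OF that(2)]] f_C[OF that] f_C[OF \<theta>s that(2)] by (simp add: abs_le_iff)
  have convC: "convex_on C (F \<theta>')" if \<theta>': "\<theta>' \<in> \<Theta>" for \<theta>'
  proof -
    have comb: "(1 - t) *\<^sub>R y + t *\<^sub>R z \<in> C \<and>
        F \<theta>' ((1 - t) *\<^sub>R y + t *\<^sub>R z) \<le> (1 - t) * F \<theta>' y + t * F \<theta>' z"
      if "y \<in> C" "z \<in> C" "0 \<le> t" "t \<le> 1" for y z t
    proof -
      let ?w = "(1 - t) *\<^sub>R y + t *\<^sub>R z"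
      have "f ?w \<theta>' \<le> ereal (1 - t) * f y \<theta>' + ereal t * f z \<theta>'"
        using f_convex[OF \<theta>'] that CX unfolding ereal_convex_on_def by auto
      then have le: "f ?w \<theta>' \<le> ereal ((1 - t) * F \<theta>' y + t * F \<theta>' z)"
        using f_C[OF \<theta>'] that by simp
      have "?w \<in> X" using X(1) that CX by (intro convexD_alt) auto
      then have "?w \<in> C" using f_not_C[OF \<theta>'] le by fastforce
      with le f_C[OF \<theta>'] show ?thesis by simp
    qed
    then have "convex C" by (auto simp: convex_alt)
    with comb show ?thesis by (intro convex_onI) auto
  qed
  have L0: "lagrangian K f h 0 y l \<theta>' = ereal (F \<theta>' y + l \<bullet> h y \<theta>')"
    if "\<theta>' \<in> \<Theta>" "y \<in> C" "l \<in> dual_cone K" for y l \<theta>'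
    using that by (simp add: lagrangian_def f_C)
  have L0': "lagrangian K f h 0 y l \<theta>' = \<infinity>"
    if "\<theta>' \<in> \<Theta>" "y \<in> X" "y \<notin> C" "l \<in> dual_cone K" for y l \<theta>'
    using that by (simp add: lagrangian_def f_not_C)
  have argminD: "y \<in> C \<and> (\<forall>w\<in>C. F \<theta>' y + l \<bullet> h y \<theta>' \<le> F \<theta>' w + l \<bullet> h w \<theta>')"
    if y: "y \<in> lagr_argmin X K f h l \<theta>'" and \<theta>': "\<theta>' \<in> \<Theta>" and l: "l \<in> dual_cone K" for y l \<theta>'
  proof -
    have yX: "y \<in> X" and min: "\<And>w. w \<in> X \<Longrightarrow> lagrangian K f h 0 y l \<theta>' \<le> lagrangian K f h 0 w l \<theta>'"
      using y by (auto simp: lagr_argmin_def is_arg_min_def not_less)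
    have "y \<in> C" using min[OF CX[OF y0C]] L0[OF \<theta>' y0C l] L0'[OF \<theta>' yX _ l] by fastforce
    with min L0[OF \<theta>' _ l] CX show ?thesis by (metis ereal_less_eq(3))
  qed
  have dual_le: "ereal r \<le> dual_fun X K f h 0 l \<theta>s \<longleftrightarrow>
      l \<in> dual_cone K \<and> (\<forall>z\<in>C. r \<le> F \<theta>s z + l \<bullet> h z \<theta>s)" for r l
  proof (cases "l \<in> dual_cone K")
    case True
    have "ereal r \<le> dual_fun X K f h 0 l \<theta>s \<longleftrightarrow> (\<forall>z\<in>X. ereal r \<le> lagrangian K f h 0 z l \<theta>s)"
      by (simp add: dual_fun_def le_INF_iff)
    also have "\<dots> \<longleftrightarrow> (\<forall>z\<in>C. r \<le> F \<theta>s z + l \<bullet> h z \<theta>s)"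
      using L0[OF \<theta>s _ True] L0'[OF \<theta>s _ _ True] CX by (metis ereal_less_eq(1,3))
    finally show ?thesis using True by simp
  next
    case False
    then have "dual_fun X K f h 0 l \<theta>s = - \<infinity>"
      using y0(1) by (auto simp: dual_fun_def lagrangian_def image_constant_conv)
    then show ?thesis using False by simp
  qed
  have dual_max: "is_arg_max (\<lambda>l. dual_fun X K f h 0 l \<theta>s) (\<lambda>_. True) l \<longleftrightarrow>
      ereal fs \<le> dual_fun X K f h 0 l \<theta>s" for l
  proof -
    have "is_arg_max (\<lambda>l. dual_fun X K f h 0 l \<theta>s) (\<lambda>_. True) l \<longleftrightarrow>
        (SUP l. dual_fun X K f h 0 l \<theta>s) \<le> dual_fun X K f h 0 l \<theta>s"
      by (simp add: is_arg_max_def not_less SUP_le_iff)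
    then show ?thesis by (simp add: no_gap opt)
  qed
  have Dx_ge: "norm y \<le> D\<^sub>x" if "y \<in> X" for y
    unfolding D\<^sub>x using X(2) that
    by (intro cSUP_upper) (auto intro!: bounded_imp_bdd_above compact_imp_bounded compact_continuous_image continuous_intros)
  have Dx0: "0 \<le> D\<^sub>x" using Dx_ge[OF y0(1)] norm_ge_zero order_trans by blast
  have bl: "bounded_linear ((*v) M)" for M :: "real ^ 'n ^ 'm" by (rule matrix_vector_mul_bounded_linear)
  have Lhx_ge: "onorm ((*v) (A \<theta>')) \<le> L\<^sub>h\<^sub>x" if "\<theta>' \<in> \<Theta>" for \<theta>'
    unfolding L\<^sub>h\<^sub>x using \<Theta>(2) that A_cont
    by (intro cSUP_upper) (auto intro!: bounded_imp_bdd_above compact_imp_bounded compact_continuous_image)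
  \<comment> \<open>A Lipschitz constant is allowed to be negative if all parameters agree; the product with \<open>e\<close> is
     nonnegative in every case.\<close>
  have scaleE: "L * norm (\<theta> k - \<theta>s) \<le> L * E k" if "0 \<le> L * e" for L k
  proof (cases "e = 0")
    case True
    then have "norm (\<theta> k - \<theta>s) \<le> 0" using \<theta>(2)[of k] by (simp add: e_def)
    then show ?thesis using True by (simp add: E_def)
  next
    case False
    then have "0 \<le> L" using that norm_ge_zero[of "\<theta> 0 - \<theta>s"] by (simp add: e_def zero_le_mult_iff)
    then show ?thesis using \<theta>(2)[of k] by (simp add: E_def e_def mult_left_mono)
  qed
  have Lf0: "0 \<le> L\<^sub>f * e" using F_lip[OF \<theta>(1)[of 0] y0C] abs_ge_zero order_trans unfolding e_def by blast
  have h_err': "norm (h y \<theta>' - h y \<theta>s) \<le> L\<^sub>h\<^sub>\<theta> * norm (\<theta>' - \<theta>s)"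
    if \<theta>': "\<theta>' \<in> \<Theta>" and y: "y \<in> X" for \<theta>' y
  proof -
    have "h y \<theta>' - h y \<theta>s = (A \<theta>' - A \<theta>s) *v y + (b \<theta>' - b \<theta>s)"
      using h \<theta>' \<theta>s by (simp add: matrix_vector_mult_diff_rdistrib)
    also have "norm \<dots> \<le> norm ((A \<theta>' - A \<theta>s) *v y) + norm (b \<theta>' - b \<theta>s)" by (rule norm_triangle_ineq)
    also have "norm ((A \<theta>' - A \<theta>s) *v y) \<le> onorm ((*v) (A \<theta>' - A \<theta>s)) * norm y" by (rule onorm[OF bl])
    also have "\<dots> \<le> onorm ((*v) (A \<theta>' - A \<theta>s)) * D\<^sub>x"
      using Dx_ge[OF y] onorm_pos_le[OF bl] by (rule mult_left_mono)
    also have "\<dots> \<le> L\<^sub>A * norm (\<theta>' - \<theta>s) * D\<^sub>x"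
      using A_lip[OF \<theta>'] Dx0 by (rule mult_right_mono)
    finally show ?thesis using b_lip[OF \<theta>'] by (simp add: L\<^sub>h\<^sub>\<theta> algebra_simps)
  qed
  have Lh0: "0 \<le> L\<^sub>h\<^sub>\<theta> * e"
    using h_err'[OF \<theta>(1)[of 0] y0(1)] norm_ge_zero order_trans unfolding e_def by blast
  have \<kappa>d: "\<exists>z z'. z \<in> C \<and> z' \<in> C \<and>
          (\<forall>w\<in>C. F (\<theta> k) z + q \<bullet> h z (\<theta> k) \<le> F (\<theta> k) w + q \<bullet> h w (\<theta> k)) \<and>
          (\<forall>w\<in>C. F \<theta>s z' + q \<bullet> h z' \<theta>s \<le> F \<theta>s w + q \<bullet> h w \<theta>s) \<and>
          norm (h z (\<theta> k) - h z' \<theta>s) \<le> \<kappa>\<^sub>d q * E k"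
    if q: "q \<in> dual_cone K" for q k
  proof -
    obtain z where z: "z \<in> lagr_argmin X K f h q (\<theta> k)" using argmin_nonempty[OF q \<theta>(1)] by blast
    then obtain z' u where z': "z' \<in> lagr_argmin X K f h q \<theta>s" and u: "u \<in> cball 0 1"
      and zz': "z = z' + (\<kappa> q * norm (\<theta> k - \<theta>s)) *\<^sub>R u"
      using argmin_lip[OF q \<theta>(1)[of k]] by (force simp: set_plus_def)
    note zC = argminD[OF z \<theta>(1) q] and z'C = argminD[OF z' \<theta>s q]
    have "h z (\<theta> k) - h z' \<theta>s = (h z (\<theta> k) - h z \<theta>s) + A \<theta>s *v (z - z')"
      using h[OF \<theta>s] by (simp add: matrix_vector_mult_diff_distrib)
    also have "norm \<dots> \<le> norm (h z (\<theta> k) - h z \<theta>s) + norm (A \<theta>s *v (z - z'))"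
      by (rule norm_triangle_ineq)
    also have "norm (A \<theta>s *v (z - z')) \<le> onorm ((*v) (A \<theta>s)) * norm (z - z')" by (rule onorm[OF bl])
    also have "\<dots> \<le> L\<^sub>h\<^sub>x * (\<kappa> q * norm (\<theta> k - \<theta>s))"
    proof (rule mult_mono)
      show "norm (z - z') \<le> \<kappa> q * norm (\<theta> k - \<theta>s)"
        using u \<kappa>(2)[OF q] by (simp add: zz' mult_left_le abs_mult)
      show "0 \<le> L\<^sub>h\<^sub>x" using Lhx_ge[OF \<theta>s] onorm_pos_le[OF bl, of "A \<theta>s"] by simp
    qed (simp_all add: Lhx_ge \<theta>s)
    finally have "norm (h z (\<theta> k) - h z' \<theta>s) \<le> \<kappa>\<^sub>d q * norm (\<theta> k - \<theta>s)"
      using h_err'[OF \<theta>(1)[of k], of z] zC CX by (simp add: \<kappa>\<^sub>d algebra_simps)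
    also have "\<dots> \<le> \<kappa>\<^sub>d q * E k"
    proof (rule scaleE)
      have "0 \<le> \<kappa> q * L\<^sub>h\<^sub>x * e"
        using \<kappa>(2)[OF q] Lhx_ge[OF \<theta>s] onorm_pos_le[OF bl, of "A \<theta>s"] by (simp add: e_def)
      then show "0 \<le> \<kappa>\<^sub>d q * e" using Lh0 by (simp add: \<kappa>\<^sub>d distrib_right)
    qed
    finally show ?thesis using zC z'C by blast
  qed
  note IP = ipalm[unfolded ipalm_def]
  have \<beta>pos: "0 < \<beta>" "\<beta> \<noteq> 0" and \<rho>pos: "0 < \<rho> k" for k using params by (auto simp: \<rho>)
  have Lk: "lagrangian K f h (\<rho> k) y (lam k) (\<theta> k) =
      f y (\<theta> k) + ereal (aug_penalty K (\<rho> k) (lam k) (h y (\<theta> k)))" for k y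
    using \<rho>pos[of k] by (simp add: lagrangian_def aug_penalty_def)
  have near_le: "lagrangian K f h (\<rho> k) (x (Suc k)) (lam k) (\<theta> k)
      \<le> lagrangian K f h (\<rho> k) z (lam k) (\<theta> k) + ereal (\<alpha> k)" if "z \<in> X" for k z
  proof -
    have "dual_fun X K f h (\<rho> k) (lam k) (\<theta> k) \<le> lagrangian K f h (\<rho> k) z (lam k) (\<theta> k)"
      unfolding dual_fun_def by (rule INF_lower[OF that])
    with IP show ?thesis by (meson add_right_mono order_trans)
  qed
  have xC: "x (Suc k) \<in> C" for k
  proof (rule ccontr)
    assume "x (Suc k) \<notin> C"
    then show False
      using near_le[OF y0(1), of k] f_not_C[OF \<theta>(1)[of k]] IP f_C[OF \<theta>(1)[of k] y0C] by (simp add: Lk)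
  qed
  have geo: "(\<lambda>k. \<rho> k * E k) = (\<lambda>k. \<rho>0 * e * (\<beta> * \<tau>) ^ k)"
    by (auto simp: \<rho> E_def power_mult_distrib)
  have bt: "norm (\<beta> * \<tau>) < 1" using params by simp
  have geo_sums: "(\<lambda>k. \<rho> k * E k) sums (\<rho>0 * e * (1 / (1 - \<beta> * \<tau>)))"
    unfolding geo by (intro sums_mult geometric_sums bt)
  have \<alpha>\<rho>: "2 * \<alpha> k * \<rho> k = 2 * \<alpha>0 * \<rho>0 * real (k + 1) powr (- 2 * (1 + c))" for k
    using \<beta>pos by (simp add: \<alpha> \<rho>)
  have sqrt_\<alpha>\<rho>: "sqrt (2 * \<alpha> k * \<rho> k) = sqrt (2 * \<alpha>0 * \<rho>0) * real (Suc k) powr (- (1 + c))" for k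
  proof -
    have "real (k + 1) powr (- 2 * (1 + c)) = (real (Suc k) powr (- (1 + c)))\<^sup>2"
      by (simp add: power2_eq_square flip: powr_add)
    then show ?thesis unfolding \<alpha>\<rho> real_sqrt_mult by simp
  qed
  have \<alpha>\<rho>_summable: "summable (\<lambda>k. sqrt (2 * \<alpha> k * \<rho> k))"
  proof -
    have "summable (\<lambda>k. real k powr (- (1 + c)))" using params by (simp add: summable_real_powr_iff)
    then have "summable (\<lambda>k. real (Suc k) powr (- (1 + c)))"
      by (rule iffD2[OF summable_Suc_iff[where f = "\<lambda>k. real k powr (- (1 + c))"]])
    then show ?thesis unfolding sqrt_\<alpha>\<rho> by (rule summable_mult)
  qed
  interpret alm: perturbed_alm K C "F \<theta>s" "\<lambda>y. h y \<theta>s" fs y0 "\<lambda>k. F (\<theta> k)" "\<lambda>k y. h y (\<theta> k)"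
    \<rho> \<alpha> E \<kappa>\<^sub>d L\<^sub>f L\<^sub>h\<^sub>\<theta> x lam
  proof
    show "closed K" "convex_cone K" by (fact K)+
    show "y0 \<in> C" "- h y0 \<theta>s \<in> K" by (fact y0C y0)+
    show "F \<theta>s y0 = fs" using y0 by (simp add: F_def)
    show "convex_on C (F (\<theta> k))" for k by (rule convC[OF \<theta>(1)])
    show "bdd_below (F (\<theta> k) ` C)" for k
      using \<kappa>d[OF zero_in_dual_cone, of k] by (auto simp: bdd_below_def)
    show "h ((1 - t) *\<^sub>R y + t *\<^sub>R z) (\<theta> k) = (1 - t) *\<^sub>R h y (\<theta> k) + t *\<^sub>R h z (\<theta> k)" for k y z t
      by (simp add: h[OF \<theta>(1)] matrix_vector_right_distrib matrix_vector_mult_scaleR algebra_simps)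
    show "bounded ((\<lambda>y. h y (\<theta> k)) ` C)" for k
    proof (rule bounded_subset)
      show "bounded ((\<lambda>y. A (\<theta> k) *v y + b (\<theta> k)) ` X)"
        using X(2) by (intro compact_imp_bounded compact_continuous_image continuous_intros
            linear_continuous_on bl)
      show "(\<lambda>y. h y (\<theta> k)) ` C \<subseteq> (\<lambda>y. A (\<theta> k) *v y + b (\<theta> k)) ` X"
        using h[OF \<theta>(1)] CX by auto
    qed
    show "\<bar>F (\<theta> k) z - F \<theta>s z\<bar> \<le> L\<^sub>f * E k" if "z \<in> C" for k z
      using F_lip[OF \<theta>(1) that] scaleE[OF Lf0] by (rule order_trans)
    show "norm (h z (\<theta> k) - h z \<theta>s) \<le> L\<^sub>h\<^sub>\<theta> * E k" if "z \<in> C" for k z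
      using h_err'[OF \<theta>(1) CX[OF that]] scaleE[OF Lh0] by (rule order_trans)
    show "continuous_on (dual_cone K) \<kappa>\<^sub>d"
      unfolding \<kappa>\<^sub>d[abs_def] by (intro continuous_intros \<kappa>(1))
    show "(\<lambda>k. 1 / \<rho> k) \<longlonglongrightarrow> 0"
    proof -
      have "(\<lambda>k. (1 / \<rho>0) * (1 / \<beta>) ^ k) \<longlonglongrightarrow> 0"
        using params by (intro tendsto_mult_right_zero LIMSEQ_power_zero) simp
      then show ?thesis by (simp add: \<rho> power_one_over)
    qed
    show "E \<longlonglongrightarrow> 0"
      unfolding E_def using params by (intro tendsto_mult_left_zero LIMSEQ_power_zero) simp
    show "summable (\<lambda>k. \<rho> k * E k)" using geo_sums by (rule sums_summable)
    show "lam 0 \<in> dual_cone K" using IP by simp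
    show "F (\<theta> k) (x (Suc k)) + aug_penalty K (\<rho> k) (lam k) (h (x (Suc k)) (\<theta> k))
        \<le> F (\<theta> k) z + aug_penalty K (\<rho> k) (lam k) (h z (\<theta> k)) + \<alpha> k" if "z \<in> C" for k z
      using near_le[OF CX[OF that], of k] f_C[OF \<theta>(1) that, of k] f_C[OF \<theta>(1) xC, of k k] by (simp add: Lk)
    show "lam (Suc k) = mult_update K (\<rho> k) (lam k) (h (x (Suc k)) (\<theta> k))" for k
    proof -
      have "lam (Suc k) = lam k + \<rho> k *\<^sub>R lagr_grad K h (\<rho> k) (x (Suc k)) (lam k) (\<theta> k)"
        using IP by blast
      then show ?thesis
        using \<rho>pos[of k] by (simp add: lagr_grad_def mult_update_def scaleR_diff_right add.commute)
    qed
  qed (use \<kappa>d \<rho>pos xC \<alpha>\<rho>_summable in auto)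
  have dual_iff: "is_arg_max (\<lambda>l. dual_fun X K f h 0 l \<theta>s) (\<lambda>_. True) l \<longleftrightarrow> alm.dual_solution l" for l
    by (simp add: dual_max dual_le alm.dual_solution_def)
  obtain ls where ls: "alm.dual_solution ls" and lim: "lam \<longlonglongrightarrow> ls"
    using alm.lam_converges dual_sol by (auto simp: dual_iff)
  have radius: "alm.radius ls = C' ls"
    unfolding alm.radius_def C' sums_unique[OF geo_sums, symmetric] by (simp add: e_def mult_ac)
  have E_eq: "E k = 1 / \<beta> ^ k * (e * \<delta> ^ k)" for k
    using \<beta>pos by (simp add: E_def params(7) power_mult_distrib)
  show ?thesis
  proof (intro exI[of _ ls] conjI impI allI)
    show "(\<lambda>k. (1 / real k) *\<^sub>R (\<Sum>i=1..k. lam i)) \<longlonglongrightarrow> ls" by (rule cesaro_mean[OF lim])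
    show "is_arg_max (\<lambda>l. dual_fun X K f h 0 l \<theta>s) (\<lambda>_. True) ls" using ls by (simp add: dual_iff)
    show "infdist (h (x (Suc k)) \<theta>s) (uminus ` K)
        \<le> 1 / \<beta> ^ k * (2 * C' ls / \<rho>0 + L\<^sub>h\<^sub>\<theta> * norm (\<theta> 0 - \<theta>s) * \<delta> ^ k)" for k
    proof -
      have "2 * alm.radius ls / \<rho> k + L\<^sub>h\<^sub>\<theta> * E k
          = 1 / \<beta> ^ k * (2 * C' ls / \<rho>0 + L\<^sub>h\<^sub>\<theta> * norm (\<theta> 0 - \<theta>s) * \<delta> ^ k)"
        by (simp add: radius E_eq \<rho> distrib_left mult_ac flip: e_def)
      with alm.infeasibility_bound[OF ls, of k] show ?thesis by simp
    qed
    show "\<bar>f (x (Suc k)) \<theta>s - ereal fs\<bar> \<le> ereal (B ls k / \<beta> ^ k)" if "L\<^sub>h\<^sub>\<theta> \<noteq> 0" for k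
    proof -
      have "\<alpha> k = \<alpha>0 / real (k + 1) powr (2 * (1 + c)) / \<beta> ^ k"
        using powr_minus_divide[of "real (k + 1)" "2 * (1 + c)"] by (simp add: \<alpha>)
      moreover have "(2 * alm.radius ls + norm ls)\<^sup>2 / \<rho> k
          = 1 / \<rho>0 * (2 * C' ls + norm ls)\<^sup>2 / \<beta> ^ k" by (simp add: radius \<rho>)
      moreover have "\<rho> k * (L\<^sub>h\<^sub>\<theta> * E k + L\<^sub>f / (\<rho> k * L\<^sub>h\<^sub>\<theta>))\<^sup>2
          = \<rho>0 * (L\<^sub>h\<^sub>\<theta> * norm (\<theta> 0 - \<theta>s) * \<delta> ^ k + L\<^sub>f / (\<rho>0 * L\<^sub>h\<^sub>\<theta>))\<^sup>2 / \<beta> ^ k"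
      proof -
        have "L\<^sub>h\<^sub>\<theta> * E k + L\<^sub>f / (\<rho> k * L\<^sub>h\<^sub>\<theta>)
            = (L\<^sub>h\<^sub>\<theta> * norm (\<theta> 0 - \<theta>s) * \<delta> ^ k + L\<^sub>f / (\<rho>0 * L\<^sub>h\<^sub>\<theta>)) / \<beta> ^ k"
          by (simp add: E_eq \<rho> add_divide_distrib mult.commute mult.left_commute flip: e_def)
        then show ?thesis using \<beta>pos by (simp add: \<rho> power_divide power2_eq_square)
      qed
      ultimately have "\<bar>F \<theta>s (x (Suc k)) - fs\<bar> \<le> B ls k / \<beta> ^ k"
        using alm.objective_bound[OF ls that, of k] by (simp add: B add_divide_distrib)
      then show ?thesis using f_C[OF \<theta>s xC, of k] by simp
    qed
  qed
qed

end
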